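(* Let $G$ be one of the four groups $\mathfrak J$, $\mathfrak{GS}$, $\mathfrak{FG}$, $\mathfrak H$ defined below. Every finitely presented group admitting an epimorphism onto $G$ is large.
   Context: For a finite alphabet $X$, $X^*$ denotes the rooted tree of finite words. Notation $g=(g_0,\dots,g_{d-1})\tau$ means the tree automorphism $g(xw)=\tau(x)\,g_x(w)$ for $x\in X=\{0,\dots,d-1\}$, $w\in X^*$, with $\tau$ a permutation of $X$ (omitted if trivial); these recursions define automorphisms uniquely. $\mathfrak J=\operatorname{IMG}(z^2+i)$: $d=2$, generated by $a=(1,1)\tau$, $b=(a,c)$, $c=(b,1)$, $\tau$ the transposition of $\{0,1\}$. Gupta–Sidki group $\mathfrak{GS}$: $d=3$, generated by $a=(1,1,1)\tau$, $b=(a,a^{-1},b)$, $\tau$ the cyclic permutation $0\mapsto1\mapsto2\mapsto0$. Fabrykowski–Gupta group $\mathfrak{FG}$: $d=3$, generated by $a=(1,1,1)\tau$, $b=(a,1,b)$, same $\tau$. Hanoi Towers group $\mathfrak H$: $d=3$, generated by $a=(a,1,1)\tau_{12}$, $b=(1,b,1)\tau_{02}$, $c=(1,1,c)\tau_{01}$, where $\tau_{ij}$ is the transposition of $i$ and $j$. A group is large if it has a finite-index subgroup admitting an epimorphism onto a non-abelian free group. *)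

theory Defs
  imports "HOL-Algebra.Algebra"
begin

definition word_eval :: "('a, 'c) monoid_scheme \<Rightarrow> ('b \<Rightarrow> 'a) \<Rightarrow> (bool \<times> 'b) list \<Rightarrow> 'a" where
  "word_eval G g w =
     foldr (\<lambda>(e, x) acc. (if e then g x else inv\<^bsub>G\<^esub> (g x)) \<otimes>\<^bsub>G\<^esub> acc) w \<one>\<^bsub>G\<^esub>"

definition reduced_word :: "(bool \<times> 'b) list \<Rightarrow> bool" where
  "reduced_word w \<longleftrightarrow>
     (\<forall>i. Suc i < length w \<longrightarrow>
        \<not> (snd (w ! i) = snd (w ! Suc i) \<and> fst (w ! i) \<noteq> fst (w ! Suc i)))"

fun reduce_word :: "(bool \<times> 'b) list \<Rightarrow> (bool \<times> 'b) list" where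
  "reduce_word [] = []"
| "reduce_word (x # xs) =
     (case reduce_word xs of
        [] \<Rightarrow> [x]
      | y # ys \<Rightarrow> (if snd y = snd x \<and> fst y \<noteq> fst x then ys else x # y # ys))"

definition free_grp :: "'b set \<Rightarrow> (bool \<times> 'b) list monoid" where
  "free_grp A =
     \<lparr>carrier = {w. set (map snd w) \<subseteq> A \<and> reduced_word w},
      monoid.mult = (\<lambda>u v. reduce_word (u @ v)),
      one = []\<rparr>"

definition normal_closure :: "('a, 'c) monoid_scheme \<Rightarrow> 'a set \<Rightarrow> 'a set" where
  "normal_closure F R =
     generate F {g \<otimes>\<^bsub>F\<^esub> r \<otimes>\<^bsub>F\<^esub> inv\<^bsub>F\<^esub> g | g r. g \<in> carrier F \<and> r \<in> R}"

definition finitely_presented :: "('a, 'c) monoid_scheme \<Rightarrow> bool" where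
  "finitely_presented \<Gamma> \<longleftrightarrow>
     (\<exists>(n::nat) g R.
        g \<in> {..<n} \<rightarrow> carrier \<Gamma> \<and>
        finite R \<and> R \<subseteq> carrier (free_grp {..<n}) \<and>
        word_eval \<Gamma> g ` carrier (free_grp {..<n}) = carrier \<Gamma> \<and>
        kernel (free_grp {..<n}) \<Gamma> (word_eval \<Gamma> g) = normal_closure (free_grp {..<n}) R)"

definition free_basis :: "('a, 'c) monoid_scheme \<Rightarrow> 'a set \<Rightarrow> bool" where
  "free_basis F B \<longleftrightarrow>
     B \<subseteq> carrier F \<and> generate F B = carrier F \<and>
     (\<forall>w. w \<noteq> [] \<longrightarrow> set (map snd w) \<subseteq> B \<longrightarrow> reduced_word w \<longrightarrow>
          word_eval F id w \<noteq> \<one>\<^bsub>F\<^esub>)"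

definition nonabelian_free_group :: "('a, 'c) monoid_scheme \<Rightarrow> bool" where
  "nonabelian_free_group F \<longleftrightarrow>
     group F \<and> (\<exists>B. free_basis F B \<and> (\<exists>x\<in>B. \<exists>y\<in>B. x \<noteq> y))"

text \<open>Large: some finite-index subgroup H admits an epimorphism onto a non-abelian free
  group. The free group is taken in type 'a set (any epimorphic image of H is isomorphic
  to a quotient H/N, whose elements are subsets of 'a).\<close>
definition large :: "('a, 'c) monoid_scheme \<Rightarrow> bool" where
  "large \<Gamma> \<longleftrightarrow>
     (\<exists>H. subgroup H \<Gamma> \<and> finite (rcosets\<^bsub>\<Gamma>\<^esub> H) \<and>
        (\<exists>(F :: 'a set monoid) h.
           nonabelian_free_group F \<and>
           h \<in> hom (\<Gamma>\<lparr>carrier := H\<rparr>) F \<and> h ` H = carrier F))"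

abbreviation tree :: "nat \<Rightarrow> nat list set" where
  "tree d \<equiv> lists {..<d}"

definition tree_group :: "nat \<Rightarrow> (nat list \<Rightarrow> nat list) set \<Rightarrow> (nat list \<Rightarrow> nat list) monoid" where
  "tree_group d gens =
     (BijGroup (tree d))\<lparr>carrier :=
        generate (BijGroup (tree d)) ((\<lambda>f. restrict f (tree d)) ` gens)\<rparr>"

subsection \<open>IMG(z^2+i): a = (1,1)t, b = (a,c), c = (b,1)\<close>
datatype stJ = JA | JB | JC
fun actJ :: "stJ \<Rightarrow> nat list \<Rightarrow> nat list" where
  "actJ s [] = []"
| "actJ JA (x # w) = (if x = 0 then 1 else if x = 1 then 0 else x) # w"
| "actJ JB (x # w) = x # (if x = 0 then actJ JA w else actJ JC w)"
| "actJ JC (x # w) = x # (if x = 0 then actJ JB w else w)"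

definition IMG_J :: "(nat list \<Rightarrow> nat list) monoid" where
  "IMG_J = tree_group 2 {actJ JA, actJ JB, actJ JC}"

subsection \<open>Gupta--Sidki: a = (1,1,1)t, b = (a, a^-1, b)\<close>
datatype stGS = GA | GAi | GB
fun actGS :: "stGS \<Rightarrow> nat list \<Rightarrow> nat list" where
  "actGS s [] = []"
| "actGS GA (x # w) = ((x + 1) mod 3) # w"
| "actGS GAi (x # w) = ((x + 2) mod 3) # w"
| "actGS GB (x # w) = x # (if x = 0 then actGS GA w else if x = 1 then actGS GAi w else actGS GB w)"

definition Gupta_Sidki :: "(nat list \<Rightarrow> nat list) monoid" where
  "Gupta_Sidki = tree_group 3 {actGS GA, actGS GB}"

subsection \<open>Fabrykowski--Gupta: a = (1,1,1)t, b = (a, 1, b)\<close>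
datatype stFG = FA | FB
fun actFG :: "stFG \<Rightarrow> nat list \<Rightarrow> nat list" where
  "actFG s [] = []"
| "actFG FA (x # w) = ((x + 1) mod 3) # w"
| "actFG FB (x # w) = x # (if x = 0 then actFG FA w else if x = 1 then w else actFG FB w)"

definition Fabrykowski_Gupta :: "(nat list \<Rightarrow> nat list) monoid" where
  "Fabrykowski_Gupta = tree_group 3 {actFG FA, actFG FB}"

subsection \<open>Hanoi Towers: a = (a,1,1)t12, b = (1,b,1)t02, c = (1,1,c)t01\<close>
datatype stH = HA | HB | HC
fun actH :: "stH \<Rightarrow> nat list \<Rightarrow> nat list" where
  "actH s [] = []"
| "actH HA (x # w) =
     (if x = 0 then 0 # actH HA w else if x = 1 then 2 # w else if x = 2 then 1 # w else x # w)"
| "actH HB (x # w) =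
     (if x = 0 then 2 # w else if x = 1 then 1 # actH HB w else if x = 2 then 0 # w else x # w)"
| "actH HC (x # w) =
     (if x = 0 then 1 # w else if x = 1 then 0 # w else if x = 2 then 2 # actH HC w else x # w)"

definition Hanoi :: "(nat list \<Rightarrow> nat list) monoid" where
  "Hanoi = tree_group 3 {actH HA, actH HB, actH HC}"

end

theory Submission
  imports Defs
begin

text \<open>Replace \<open>G\<close> by a virtually free group \<open>F\<close> on the same generators: \<open>C\<^sub>2 * C\<^sub>2 * C\<^sub>2\<close> for
  \<open>\<JJ>\<close> and the Hanoi group, \<open>C\<^sub>3 * C\<^sub>3\<close> for the other two. The wreath recursion lets the
  generators act on \<open>X\<^sup>n \<times> F\<close> for every \<open>n\<close>. Sections shorten reduced words until only single
  letters are left, and these act nontrivially on the tree; hence a word that is trivial in \<open>G\<close>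
  acts trivially on \<open>X\<^sup>n \<times> F\<close> for all large \<open>n\<close>. So the finitely many relators of \<open>\<Gamma>\<close> die there
  for some \<open>n\<close>, and \<open>\<Gamma>\<close> maps onto the group generated by the letters acting on \<open>X\<^sup>n \<times> F\<close>. The
  stabiliser of the vertex \<open>0\<^sup>n\<close> has finite index and, by self-replication, acts on the fibre
  above it as all of \<open>F\<close>, which is large.\<close>

section \<open>Free groups\<close>

text \<open>A finitely presented group controls only finitely many relations, so the target has to
  approximate G at a finite level and still contain a free part. This pulls on F in two directions.
  Its relations must survive the wreath recursion, or the letters would not act compatibly on
  \<open>X^n x F\<close>; yet they must suffice to make every word of length at least 2 to which
  none applies lose length in its sections. Relations inside single cyclic factors meet both
  demands. Of F two properties enter: these relations hold in it, and a finite-index subgroup N maps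
  onto a free group. Killing the relators only gives a map into the group generated by the letters.
  It is onto because in G each letter is the image of a word in the generators of
  \<open>\<Gamma>\<close>, and these finitely many equalities also hold from some level on. Inside
  the stabiliser of \<open>0^n\<close> one passes to the preimage of N before mapping to the free
  group.\<close>

definition push :: "bool \<times> 'b \<Rightarrow> (bool \<times> 'b) list \<Rightarrow> (bool \<times> 'b) list" where
  "push x w = (case w of [] \<Rightarrow> [x]
     | y # ys \<Rightarrow> if snd y = snd x \<and> fst y \<noteq> fst x then ys else x # y # ys)"

abbreviation flip :: "bool \<times> 'b \<Rightarrow> bool \<times> 'b" where
  "flip x \<equiv> (\<not> fst x, snd x)"

lemma reduce_word_Cons: "reduce_word (x # xs) = push x (reduce_word xs)"
  by (simp add: push_def)

declare reduce_word.simps(2)[simp del]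
declare reduce_word_Cons[simp]

lemma reduced_word_Nil [simp]: "reduced_word []"
  by (simp add: reduced_word_def)

lemma reduced_word_Cons:
  "reduced_word (x # xs) \<longleftrightarrow> reduced_word xs \<and> (xs = [] \<or> hd xs \<noteq> flip x)"
proof (cases xs)
  case Nil
  then show ?thesis by (simp add: reduced_word_def)
next
  case (Cons y ys)
  have split: "(\<forall>i. P i) \<longleftrightarrow> P 0 \<and> (\<forall>i. P (Suc i))" for P :: "nat \<Rightarrow> bool"
    by (metis nat.exhaust)
  have "reduced_word (x # xs) \<longleftrightarrow> y \<noteq> flip x \<and> reduced_word xs"
    unfolding reduced_word_def Cons by (subst split) (auto simp: prod_eq_iff)
  then show ?thesis using Cons by auto
qed

lemma push_eq: "push x w = (if w \<noteq> [] \<and> hd w = flip x then tl w else x # w)"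
  by (cases w) (auto simp: push_def prod_eq_iff)

lemma reduced_word_push [simp]: "reduced_word w \<Longrightarrow> reduced_word (push x w)"
  by (cases w) (auto simp: push_eq reduced_word_Cons)

lemma reduced_word_reduce [simp]: "reduced_word (reduce_word w)"
  by (induction w) auto

lemma reduce_word_reduced: "reduced_word w \<Longrightarrow> reduce_word w = w"
  by (induction w) (auto simp: reduced_word_Cons push_eq)

text \<open>Van der Waerden's device: letters act on reduced words as permutations,
  \<open>flip x\<close> undoing \<open>x\<close>. If the inner \<open>push\<close> cancels a leading
  \<open>x\<close>, reducedness of \<open>w\<close> keeps the next letter from being
  \<open>flip x\<close>, so the outer one restores \<open>x\<close>. Associativity of
  \<open>free_grp\<close> rests on this.\<close>

lemma push_push_flip: "reduced_word w \<Longrightarrow> push x (push (flip x) w) = w"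
  by (cases w) (auto simp: push_eq reduced_word_Cons prod_eq_iff)

lemma reduce_word_append: "reduce_word (u @ v) = foldr push u (reduce_word v)"
  by (induction u) auto

lemma reduce_word_append_reduce: 
  "reduce_word (u @ reduce_word v) = reduce_word (u @ v)"
  "reduce_word (reduce_word u @ v) = reduce_word (u @ v)"
proof -
  show "reduce_word (u @ reduce_word v) = reduce_word (u @ v)"
    by (simp add: reduce_word_append reduce_word_reduced)
  show "reduce_word (reduce_word u @ v) = reduce_word (u @ v)"
  proof (induction u)
    case (Cons x u)
    show ?case
    proof (cases "reduce_word u \<noteq> [] \<and> hd (reduce_word u) = flip x")
      case True
      then obtain ys where ys: "reduce_word u = flip x # ys"
        by (cases "reduce_word u") auto
      have "reduce_word (reduce_word (x # u) @ v) = reduce_word (ys @ v)"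
        by (simp add: ys push_eq)
      \<comment> \<open>Inserting a cancelling pair restores the letter \<open>flip x\<close> that
        the reduction of \<open>x # u\<close> had absorbed.\<close>
      also have "\<dots> = push x (push (flip x) (reduce_word (ys @ v)))"
        by (simp only: push_push_flip reduced_word_reduce)
      also have "\<dots> = push x (reduce_word (reduce_word u @ v))" 
        by (simp add: ys)
      finally show ?thesis using Cons by simp
    next
      case False
      then show ?thesis using Cons by (auto simp: push_eq)
    qed
  qed simp
qed

lemma set_push: "snd ` set (push x w) \<subseteq> insert (snd x) (snd ` set w)"
  by (cases w) (auto simp: push_eq)

lemma set_reduce_word: "snd ` set (reduce_word w) \<subseteq> snd ` set w"
proof (induction w)
  case (Cons x w)
  then show ?case using set_push[of x "reduce_word w"] by (simp, blast)
qed simp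

definition inv_word :: "(bool \<times> 'b) list \<Rightarrow> (bool \<times> 'b) list" where
  "inv_word w = rev (map flip w)"

lemma inv_word_Cons: "inv_word (x # w) = inv_word w @ [flip x]"
  by (simp add: inv_word_def)

lemma set_inv_word: "snd ` set (inv_word w) = snd ` set w"
  by (simp add: inv_word_def image_image)

lemma reduce_word_inv_word: "reduce_word (inv_word w @ w) = []"
proof (induction w)
  case (Cons x w)
  have "reduce_word (inv_word (x # w) @ x # w)
      = foldr push (inv_word w) (push (flip x) (push (flip (flip x)) (reduce_word w)))"
    by (simp add: inv_word_Cons reduce_word_append)
  also have "\<dots> = reduce_word (inv_word w @ w)"
    by (simp only: push_push_flip reduced_word_reduce reduce_word_append)
  finally show ?case using Cons by simp
qed (simp add: inv_word_def)

lemma carrier_free_grp: "w \<in> carrier (free_grp A) \<longleftrightarrow> snd ` set w \<subseteq> A \<and> reduced_word w"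
  by (simp add: free_grp_def)

lemma mult_free_grp: "u \<otimes>\<^bsub>free_grp A\<^esub> v = reduce_word (u @ v)"
  by (simp add: free_grp_def)

lemma one_free_grp: "\<one>\<^bsub>free_grp A\<^esub> = []"
  by (simp add: free_grp_def)

lemma reduce_word_carrier:
  "snd ` set w \<subseteq> A \<Longrightarrow> reduce_word w \<in> carrier (free_grp A)"
  using set_reduce_word[of w] by (auto simp: carrier_free_grp)

lemma group_free_grp: "group (free_grp A)"
proof (rule groupI)
  fix u v w
  assume "u \<in> carrier (free_grp A)" "v \<in> carrier (free_grp A)" "w \<in> carrier (free_grp A)"
  show "u \<otimes>\<^bsub>free_grp A\<^esub> v \<otimes>\<^bsub>free_grp A\<^esub> w = u \<otimes>\<^bsub>free_grp A\<^esub> (v \<otimes>\<^bsub>free_grp A\<^esub> w)"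
    by (simp add: mult_free_grp reduce_word_append_reduce)
next
  fix u assume u: "u \<in> carrier (free_grp A)"
  show "\<exists>v\<in>carrier (free_grp A). v \<otimes>\<^bsub>free_grp A\<^esub> u = \<one>\<^bsub>free_grp A\<^esub>"
  proof
    show "reduce_word (inv_word u) \<in> carrier (free_grp A)"
      using u by (intro reduce_word_carrier) (simp add: carrier_free_grp set_inv_word)
    show "reduce_word (inv_word u) \<otimes>\<^bsub>free_grp A\<^esub> u = \<one>\<^bsub>free_grp A\<^esub>"
      by (simp add: mult_free_grp one_free_grp reduce_word_append_reduce reduce_word_inv_word)
  qed
next
  fix u v
  assume "u \<in> carrier (free_grp A)" "v \<in> carrier (free_grp A)"
  then show "u \<otimes>\<^bsub>free_grp A\<^esub> v \<in> carrier (free_grp A)"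
    unfolding mult_free_grp
    by (intro reduce_word_carrier) (simp add: carrier_free_grp image_Un)
qed (simp_all add: mult_free_grp one_free_grp carrier_free_grp reduce_word_reduced)

section \<open>Evaluation of words in a group\<close>

lemma word_eval_Nil [simp]: "word_eval G g [] = \<one>\<^bsub>G\<^esub>"
  by (simp add: word_eval_def)

lemma word_eval_Cons:
  "word_eval G g (x # w) =
     (if fst x then g (snd x) else inv\<^bsub>G\<^esub> (g (snd x))) \<otimes>\<^bsub>G\<^esub> word_eval G g w"
  by (simp add: word_eval_def split: prod.splits)

context group
begin

lemma word_eval_closed:
  "g ` snd ` set w \<subseteq> carrier G \<Longrightarrow> word_eval G g w \<in> carrier G"
  by (induction w) (auto simp: word_eval_Cons)

lemma word_eval_append:
  assumes "g ` snd ` set u \<subseteq> carrier G" "g ` snd ` set v \<subseteq> carrier G"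
  shows "word_eval G g (u @ v) = word_eval G g u \<otimes> word_eval G g v"
  using assms by (induction u) (auto simp: word_eval_Cons word_eval_closed m_assoc)

lemma word_eval_push:
  assumes "g (snd x) \<in> carrier G" "g ` snd ` set w \<subseteq> carrier G"
  shows "word_eval G g (push x w) = word_eval G g (x # w)"
  using assms by (cases w)
    (auto simp: push_eq word_eval_Cons word_eval_closed m_assoc[symmetric])

lemma word_eval_reduce:
  assumes "g ` snd ` set w \<subseteq> carrier G"
  shows "word_eval G g (reduce_word w) = word_eval G g w"
  using assms
proof (induction w)
  case (Cons x w)
  have "g ` snd ` set (reduce_word w) \<subseteq> carrier G"
    using Cons.prems set_reduce_word[of w] by auto
  then show ?case using Cons by (simp add: word_eval_push word_eval_Cons)
qed simp

lemma word_eval_hom: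
  assumes "g \<in> A \<rightarrow> carrier G"
  shows "word_eval G g \<in> hom (free_grp A) G"
proof (rule homI)
  fix u v assume "u \<in> carrier (free_grp A)" "v \<in> carrier (free_grp A)"
  then have "g ` snd ` set u \<subseteq> carrier G" "g ` snd ` set v \<subseteq> carrier G"
    using assms unfolding carrier_free_grp by blast+
  then show "word_eval G g u \<in> carrier G"
    "word_eval G g (u \<otimes>\<^bsub>free_grp A\<^esub> v) = word_eval G g u \<otimes> word_eval G g v"
    by (simp_all add: word_eval_closed word_eval_append mult_free_grp image_Un word_eval_reduce)
qed

lemma foldr_mult_closed:
  assumes "\<And>s. \<beta> s \<in> carrier G"
  shows "foldr (\<lambda>s f. \<beta> s \<otimes> f) w \<one> \<in> carrier G"
  using assms by (induction w) auto

lemma foldr_mult_append: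
  assumes "\<And>s. \<beta> s \<in> carrier G"
  shows "foldr (\<lambda>s f. \<beta> s \<otimes> f) (u @ w) \<one> =
    foldr (\<lambda>s f. \<beta> s \<otimes> f) u \<one> \<otimes> foldr (\<lambda>s f. \<beta> s \<otimes> f) w \<one>"
  using assms foldr_mult_closed[of \<beta>]
  by (induction u) (auto simp del: foldr_append simp: m_assoc)

end

lemma free_grp_Cons:
  assumes "x # w \<in> carrier (free_grp A)"
  shows "[x] \<in> carrier (free_grp A)" "w \<in> carrier (free_grp A)"
    "x # w = [x] \<otimes>\<^bsub>free_grp A\<^esub> w"
  using assms by (auto simp: carrier_free_grp mult_free_grp reduced_word_Cons reduce_word_reduced push_eq)

lemma inv_free_grp:
  assumes "w \<in> carrier (free_grp A)"
  shows "inv\<^bsub>free_grp A\<^esub> w = reduce_word (inv_word w)"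
proof (rule group.inv_equality[OF group_free_grp _ assms])
  show "reduce_word (inv_word w) \<otimes>\<^bsub>free_grp A\<^esub> w = \<one>\<^bsub>free_grp A\<^esub>"
    by (simp add: mult_free_grp one_free_grp reduce_word_append_reduce reduce_word_inv_word)
  show "reduce_word (inv_word w) \<in> carrier (free_grp A)"
    using assms by (intro reduce_word_carrier) (simp add: carrier_free_grp set_inv_word)
qed

lemma hom_free_grp_eq_word_eval:
  assumes "group G" and h: "h \<in> hom (free_grp A) G" and w: "w \<in> carrier (free_grp A)"
  shows "h w = word_eval G (\<lambda>i. h [(True, i)]) w"
  using w
proof (induction w)
  case Nil
  show ?case
    using hom_one[OF h group_free_grp assms(1)] by (simp add: one_free_grp)
next
  case (Cons x w)
  interpret group_hom "free_grp A" G h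
    using assms(1) h group_free_grp by (simp add: group_hom_def group_hom_axioms_def)
  note c = free_grp_Cons[OF Cons.prems]
  have i: "snd x \<in> A" using Cons.prems by (simp add: carrier_free_grp)
  then have t: "[(True, snd x)] \<in> carrier (free_grp A)"
    by (simp add: carrier_free_grp reduced_word_Cons)
  have "h [x] = (if fst x then h [(True, snd x)] else inv\<^bsub>G\<^esub> (h [(True, snd x)]))"
    using hom_inv[OF t] unfolding inv_free_grp[OF t]
    by (cases x) (auto simp: inv_word_def push_eq)
  moreover have "h (x # w) = h [x] \<otimes>\<^bsub>G\<^esub> h w"
    using c by (metis hom_mult)
  ultimately show ?case using Cons.IH[OF c(2)] by (simp add: word_eval_Cons)
qed

section \<open>Free quotients and largeness\<close>

lemma nonabelian_free_group_if_iso_free_grp: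
  assumes "group F" and iso: "h \<in> iso (free_grp A) F" and ij: "i \<in> A" "j \<in> A" "i \<noteq> j"
  shows "nonabelian_free_group F"
proof -
  define g where "g = (\<lambda>i. h [(True, i)])"
  have hom: "h \<in> hom (free_grp A) F" and bij: "bij_betw h (carrier (free_grp A)) (carrier F)"
    using iso by (auto simp: iso_def)
  have letter: "[(e, i)] \<in> carrier (free_grp A)" if "i \<in> A" for e i
    using that by (simp add: carrier_free_grp reduced_word_Cons)
  have inj: "inj_on g A"
    unfolding g_def
    by (rule inj_onI) (use bij letter in \<open>force simp: inj_on_def bij_betw_def\<close>)
  have gB: "g ` A \<subseteq> carrier F"
    unfolding g_def using bij letter by (auto simp: bij_betw_def)
  interpret F: group F by fact
  have gen: "generate F (g ` A) = carrier F"
  proof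
    show "generate F (g ` A) \<subseteq> carrier F"
      using F.generate_incl[OF gB] .
    have "word_eval F g w \<in> generate F (g ` A)" if "snd ` set w \<subseteq> A" for w
      using that by (induction w)
        (auto simp: word_eval_Cons intro: generate.one generate.eng generate.incl generate.inv)
    then show "carrier F \<subseteq> generate F (g ` A)"
      using bij hom_free_grp_eq_word_eval[OF assms(1) hom, folded g_def]
      by (force simp: bij_betw_def carrier_free_grp)
  qed
  have free: "word_eval F id w \<noteq> \<one>\<^bsub>F\<^esub>"
    if w: "w \<noteq> []" "set (map snd w) \<subseteq> g ` A" "reduced_word w" for w
  proof
    assume 1: "word_eval F id w = \<one>\<^bsub>F\<^esub>"
    \<comment> \<open>\<open>free_basis\<close> spells words with the basis elements themselves, so
      \<open>w\<close> is renamed along the inverse of the injection \<open>g\<close>; renaming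
      keeps it reduced.\<close>
    define v where "v = map (\<lambda>(e, b). (e, inv_into A g b)) w"
    have v: "v \<noteq> []" "snd ` set v \<subseteq> A"
      using w by (auto simp: v_def inv_into_into)
    have "word_eval F g v = word_eval F id w \<and> reduced_word v"
      using w(2,3) unfolding v_def
    proof (induction w)
      case (Cons x w)
      then show ?case
        using inj_on_inv_into[of "g ` A" g A]
        by (cases w) (auto simp: word_eval_Cons reduced_word_Cons f_inv_into_f inj_on_def split: prod.splits)
    qed simp
    then have "word_eval F g v = \<one>\<^bsub>F\<^esub>" "v \<in> carrier (free_grp A)"
      using 1 v by (auto simp: carrier_free_grp)
    then have "h v = h []" "v \<in> carrier (free_grp A)" "[] \<in> carrier (free_grp A)"
      using hom_free_grp_eq_word_eval[OF assms(1) hom, folded g_def]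
      by (auto simp: carrier_free_grp)
    then show False using bij v(1) by (auto simp: bij_betw_def inj_on_def)
  qed
  have "free_basis F (g ` A)"
    unfolding free_basis_def using gen gB free by blast
  moreover have "g i \<noteq> g j" using inj ij by (auto simp: inj_on_def)
  ultimately show ?thesis
    unfolding nonabelian_free_group_def using assms(1) ij by blast
qed

text \<open>\<open>large\<close> asks for a free group whose elements are sets of elements of
  \<open>\<Gamma>\<close>; the quotient of \<open>H\<close> by the kernel of \<open>h\<close> is a
  copy of \<open>free_grp A\<close> of that type.\<close>

lemma large_if_epi_free_grp:
  fixes \<Gamma> :: "('a, 'c) monoid_scheme"
  assumes "group \<Gamma>" and H: "subgroup H \<Gamma>" "finite (rcosets\<^bsub>\<Gamma>\<^esub> H)"
    and h: "h \<in> hom (\<Gamma>\<lparr>carrier := H\<rparr>) (free_grp A)" "h ` H = carrier (free_grp A)"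
    and ij: "i \<in> A" "j \<in> A" "i \<noteq> j"
  shows "large \<Gamma>"
proof -
  let ?H = "\<Gamma>\<lparr>carrier := H\<rparr>"
  have gH: "group ?H" using group.subgroup_imp_group[OF assms(1) H(1)] .
  interpret group_hom ?H "free_grp A" h
    using gH h(1) group_free_grp by (simp add: group_hom_def group_hom_axioms_def)
  define F where "F = ?H Mod kernel ?H (free_grp A) h"
  have N: "kernel ?H (free_grp A) h \<lhd> ?H" by (rule normal_kernel)
  have gF: "group F" unfolding F_def by (rule normal.factorgroup_is_group[OF N])
  have iso: "(\<lambda>C. the_elem (h ` C)) \<in> iso F (free_grp A)"
    unfolding F_def using FactGroup_iso_set h(2) by simp
  have "nonabelian_free_group F"
    using nonabelian_free_group_if_iso_free_grp[OF gF group.iso_set_sym[OF gF iso] ij] .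
  moreover have "r_coset ?H (kernel ?H (free_grp A) h) \<in> hom ?H F"
    unfolding F_def by (rule normal.r_coset_hom_Mod[OF N])
  moreover have "r_coset ?H (kernel ?H (free_grp A) h) ` H = carrier F"
    unfolding F_def by (auto simp: FactGroup_def RCOSETS_def)
  ultimately show ?thesis unfolding large_def using H by blast
qed


section \<open>Induced homomorphisms, normal closures and finite index\<close>

lemma hom_word_eval:
  assumes "group_hom G H h" "g ` snd ` set w \<subseteq> carrier G"
  shows "h (word_eval G g w) = word_eval H (h \<circ> g) w"
proof -
  interpret group_hom G H h by fact
  show ?thesis
    using assms(2) by (induction w) (auto simp: word_eval_Cons G.word_eval_closed)
qed

lemma hom_factors_through_epi:
  assumes f: "group_hom A B f" "f ` carrier A = carrier B" and h: "group_hom A C h"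
    and ker: "kernel A B f \<subseteq> kernel A C h"
  shows "\<exists>\<Phi>\<in>hom B C. \<forall>a\<in>carrier A. \<Phi> (f a) = h a"
proof -
  interpret f: group_hom A B f by fact
  interpret h: group_hom A C h by fact
  have eq: "h a = h b" if ab: "a \<in> carrier A" "b \<in> carrier A" "f a = f b" for a b
  proof -
    have "a \<otimes>\<^bsub>A\<^esub> inv\<^bsub>A\<^esub> b \<in> kernel A B f"
      using ab by (simp add: kernel_def)
    then have "h (a \<otimes>\<^bsub>A\<^esub> inv\<^bsub>A\<^esub> b) = \<one>\<^bsub>C\<^esub>"
      using ker unfolding kernel_def by blast
    then have "h a \<otimes>\<^bsub>C\<^esub> inv\<^bsub>C\<^esub> h b = \<one>\<^bsub>C\<^esub>"
      using ab by simp
    then show ?thesis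
      using ab h.H.inv_solve_right'[of "\<one>\<^bsub>C\<^esub>" "h a" "h b"] by simp
  qed
  define \<Phi> where "\<Phi> b = h (inv_into (carrier A) f b)" for b
  have \<Phi>: "\<Phi> (f a) = h a" if "a \<in> carrier A" for a
    unfolding \<Phi>_def using that by (intro eq) (auto simp: inv_into_into f_inv_into_f)
  have "\<Phi> \<in> hom B C"
  proof (rule homI)
    fix x y assume "x \<in> carrier B" "y \<in> carrier B"
    then obtain a b where "a \<in> carrier A" "x = f a" "b \<in> carrier A" "y = f b"
      using f(2) by blast
    then show "\<Phi> x \<in> carrier C" "\<Phi> (x \<otimes>\<^bsub>B\<^esub> y) = \<Phi> x \<otimes>\<^bsub>C\<^esub> \<Phi> y"
      using \<Phi>[of "a \<otimes>\<^bsub>A\<^esub> b"] by (simp_all add: \<Phi>)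
  qed
  then show ?thesis using \<Phi> by blast
qed

lemma normal_closure_subset_kernel:
  assumes "group_hom A C h" "R \<subseteq> kernel A C h"
  shows "normal_closure A R \<subseteq> kernel A C h"
proof -
  interpret group_hom A C h by fact
  have "{g \<otimes>\<^bsub>A\<^esub> r \<otimes>\<^bsub>A\<^esub> inv\<^bsub>A\<^esub> g | g r. g \<in> carrier A \<and> r \<in> R} \<subseteq> kernel A C h"
    using assms(2) by (fastforce simp: kernel_def)
  then show ?thesis
    unfolding normal_closure_def using G.generate_subgroup_incl subgroup_kernel by blast
qed

text \<open>The fibres of \<open>\<rho>\<close> lie inside right cosets, so a coset is recovered
  from any value taken on it, and finitely many values leave finitely many cosets.\<close>

lemma finite_rcosets_if_finite_invariant:
  assumes "group G" "subgroup H G" "finite (\<rho> ` carrier G)"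
    and inv: "\<And>x y. \<lbrakk>x \<in> carrier G; y \<in> carrier G; \<rho> x = \<rho> y\<rbrakk> \<Longrightarrow> x \<otimes>\<^bsub>G\<^esub> inv\<^bsub>G\<^esub> y \<in> H"
  shows "finite (rcosets\<^bsub>G\<^esub> H)"
proof -
  interpret group G by fact
  interpret subgroup H G by fact
  have "H #>\<^bsub>G\<^esub> x = H #>\<^bsub>G\<^esub> inv_into (carrier G) \<rho> (\<rho> x)" if x: "x \<in> carrier G" for x
  proof -
    let ?y = "inv_into (carrier G) \<rho> (\<rho> x)"
    have y: "?y \<in> carrier G" "\<rho> ?y = \<rho> x"
      using x by (auto simp: inv_into_into f_inv_into_f)
    have "x \<in> H #>\<^bsub>G\<^esub> ?y"
      using rcos_module_rev[OF assms(1) y(1) x] inv[OF x y(1)] y(2) by simp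
    then show ?thesis
      using repr_independence[OF _ y(1) assms(2)] by simp
  qed
  then have "rcosets\<^bsub>G\<^esub> H \<subseteq> (\<lambda>z. H #>\<^bsub>G\<^esub> inv_into (carrier G) \<rho> z) ` \<rho> ` carrier G"
    unfolding RCOSETS_def by blast
  then show ?thesis using assms(3) by (meson finite_imageI finite_subset)
qed

section \<open>Words acting on a rooted tree\<close>

text \<open>A letter \<open>s\<close> stands for the tree automorphism \<open>xw \<mapsto> \<tau> s x \<cdot> (\<delta> s x)(w)\<close>, where the
  section \<open>\<delta> s x\<close> is again a word; the rightmost letter of a word acts first.\<close>

primrec wout :: "('s \<Rightarrow> nat \<Rightarrow> nat) \<Rightarrow> 's list \<Rightarrow> nat \<Rightarrow> nat" where
  "wout \<tau> [] x = x"
| "wout \<tau> (s # w) x = \<tau> s (wout \<tau> w x)"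

primrec wsec :: "('s \<Rightarrow> nat \<Rightarrow> nat) \<Rightarrow> ('s \<Rightarrow> nat \<Rightarrow> 's list) \<Rightarrow> 's list \<Rightarrow> nat \<Rightarrow> 's list" where
  "wsec \<tau> \<delta> [] x = []"
| "wsec \<tau> \<delta> (s # w) x = \<delta> s (wout \<tau> w x) @ wsec \<tau> \<delta> w x"

primrec out :: "('s \<Rightarrow> nat \<Rightarrow> nat) \<Rightarrow> ('s \<Rightarrow> nat \<Rightarrow> 's list) \<Rightarrow> 's list \<Rightarrow> nat list \<Rightarrow> nat list" where
  "out \<tau> \<delta> w [] = []"
| "out \<tau> \<delta> w (x # xs) = wout \<tau> w x # out \<tau> \<delta> (wsec \<tau> \<delta> w x) xs"

primrec sec :: "('s \<Rightarrow> nat \<Rightarrow> nat) \<Rightarrow> ('s \<Rightarrow> nat \<Rightarrow> 's list) \<Rightarrow> 's list \<Rightarrow> nat list \<Rightarrow> 's list" where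
  "sec \<tau> \<delta> w [] = w"
| "sec \<tau> \<delta> w (x # xs) = sec \<tau> \<delta> (wsec \<tau> \<delta> w x) xs"

lemma wout_append: "wout \<tau> (u @ w) x = wout \<tau> u (wout \<tau> w x)"
  by (induction u) auto

lemma wsec_append: "wsec \<tau> \<delta> (u @ w) x = wsec \<tau> \<delta> u (wout \<tau> w x) @ wsec \<tau> \<delta> w x"
  by (induction u) (auto simp: wout_append)

lemma out_Nil [simp]: "out \<tau> \<delta> [] xs = xs"
  by (induction xs) auto

lemma sec_Nil [simp]: "sec \<tau> \<delta> [] xs = []"
  by (induction xs) auto

lemma out_append: "out \<tau> \<delta> (u @ w) xs = out \<tau> \<delta> u (out \<tau> \<delta> w xs)"
  by (induction xs arbitrary: u w) (auto simp: wout_append wsec_append)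

lemma sec_append: "sec \<tau> \<delta> (u @ w) xs = sec \<tau> \<delta> u (out \<tau> \<delta> w xs) @ sec \<tau> \<delta> w xs"
  by (induction xs arbitrary: u w) (auto simp: wsec_append)

lemma out_append_path: "out \<tau> \<delta> w (xs @ ys) = out \<tau> \<delta> w xs @ out \<tau> \<delta> (sec \<tau> \<delta> w xs) ys"
  by (induction xs arbitrary: w) auto

lemma sec_append_path: "sec \<tau> \<delta> w (xs @ ys) = sec \<tau> \<delta> (sec \<tau> \<delta> w xs) ys"
  by (induction xs arbitrary: w) auto

lemma length_out [simp]: "length (out \<tau> \<delta> w xs) = length xs"
  by (induction xs arbitrary: w) auto

definition level :: "nat \<Rightarrow> nat \<Rightarrow> nat list set" where
  "level d n = {xs. set xs \<subseteq> {..<d} \<and> length xs = n}"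

lemma finite_level: "finite (level d n)"
  unfolding level_def by (rule finite_lists_length_eq) simp

lemma level_imp_tree: "xs \<in> level d n \<Longrightarrow> xs \<in> tree d"
  by (auto simp: level_def)

text \<open>\<open>mrg s t = Some r\<close> is a relation \<open>st = r\<close> shortening words; it holds in \<open>F\<close> and is
  inherited by sections. Pairs without such a relation lose a letter after \<open>k\<close> levels. The
  group \<open>F\<close> is a large group on the same letters, with \<open>p\<close> an epimorphism of its
  finite-index subgroup \<open>N\<close> onto a free group.\<close>

locale large_letters = F: group F for F :: "('f, 'm) monoid_scheme" (structure) +
  fixes linv :: "'s \<Rightarrow> 's" and mrg :: "'s \<Rightarrow> 's \<Rightarrow> 's list option"
    and \<beta> :: "'s \<Rightarrow> 'f" and N :: "'f set" and p :: "'f \<Rightarrow> (bool \<times> 'i) list" and I :: "'i set"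
  assumes finite_letters: "finite (UNIV :: 's set)"
    and linv_linv [simp]: "linv (linv s) = s"
    and mrg_linv: "mrg s (linv s) = Some []"
    and length_mrg: "mrg s t = Some r \<Longrightarrow> length r \<le> 1"
    and beta_closed [simp]: "\<beta> s \<in> carrier F"
    and beta_mrg: "mrg s t = Some r \<Longrightarrow> \<beta> s \<otimes> \<beta> t = foldr (\<lambda>s f. \<beta> s \<otimes> f) r \<one>"
    and N_subgroup: "subgroup N F" and N_finite_index: "finite (rcosets N)"
    and p_hom: "p \<in> hom (F\<lparr>carrier := N\<rparr>) (free_grp I)"
    and p_surj: "u \<in> carrier (free_grp I) \<Longrightarrow>
      \<exists>w. foldr (\<lambda>s f. \<beta> s \<otimes> f) w \<one> \<in> N \<and> p (foldr (\<lambda>s f. \<beta> s \<otimes> f) w \<one>) = u"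
    and I_nontrivial: "\<exists>i\<in>I. \<exists>j\<in>I. i \<noteq> j"

text \<open>The tree side, kept apart because each model \<open>F\<close> serves two groups. In
  \<open>wsec_mrg\<close> a section of \<open>s t\<close> either is the section of \<open>r\<close>
  already or is a pair merging to it; this closes the induction along a vertex in
  \<open>act_mrg\<close>.\<close>

locale contracting_letters =
  large_letters F linv mrg \<beta> N p I for F :: "('f, 'm) monoid_scheme" (structure)
    and linv :: "'s \<Rightarrow> 's" and mrg \<beta> N and p :: "'f \<Rightarrow> (bool \<times> 'i) list" and I +
  fixes d k :: nat and \<tau> :: "'s \<Rightarrow> nat \<Rightarrow> nat" and \<delta> :: "'s \<Rightarrow> nat \<Rightarrow> 's list"
  assumes d_pos: "0 < d"
    and tau_less: "x < d \<Longrightarrow> \<tau> s x < d"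
    and length_section: "x < d \<Longrightarrow> length (\<delta> s x) \<le> 1"
    and wout_mrg: "\<lbrakk>mrg s t = Some r; x < d\<rbrakk> \<Longrightarrow> wout \<tau> [s, t] x = wout \<tau> r x"
    and wsec_mrg: "\<lbrakk>mrg s t = Some r; x < d\<rbrakk> \<Longrightarrow>
      wsec \<tau> \<delta> [s, t] x = wsec \<tau> \<delta> r x \<or>
      (\<exists>s' t'. wsec \<tau> \<delta> [s, t] x = [s', t'] \<and> mrg s' t' = Some (wsec \<tau> \<delta> r x))"
    and no_mrg: "\<lbrakk>mrg s t = None; xs \<in> level d k\<rbrakk> \<Longrightarrow> length (sec \<tau> \<delta> [s, t] xs) \<le> 1"
    and letter_nontrivial: "\<exists>xs\<in>tree d. out \<tau> \<delta> [s] xs \<noteq> xs"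
    and self_replicating: "\<exists>w. wout \<tau> w 0 = 0 \<and> wsec \<tau> \<delta> w 0 = [s]"
begin

abbreviation ev :: "'s list \<Rightarrow> 'f" where
  "ev w \<equiv> foldr (\<lambda>s f. \<beta> s \<otimes> f) w \<one>"

abbreviation act :: "'s list \<Rightarrow> nat list \<Rightarrow> nat list" where
  "act \<equiv> out \<tau> \<delta>"

abbreviation sect :: "'s list \<Rightarrow> nat list \<Rightarrow> 's list" where
  "sect \<equiv> sec \<tau> \<delta>"

section \<open>Letter relations and inverses under the action\<close>

lemma ev_closed [simp]: "ev w \<in> carrier F"
  by (rule F.foldr_mult_closed) simp

lemma ev_append: "ev (u @ w) = ev u \<otimes> ev w"
  by (rule F.foldr_mult_append) simp

lemma wout_less: "x < d \<Longrightarrow> wout \<tau> w x < d"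
  by (induction w) (auto simp: tau_less)

lemma act_tree: "xs \<in> tree d \<Longrightarrow> act w xs \<in> tree d"
  by (induction xs arbitrary: w) (auto simp: wout_less)

lemma act_level: "xs \<in> level d n \<Longrightarrow> act w xs \<in> level d n"
  using act_tree[of xs w] by (auto simp: level_def in_lists_conv_set subset_iff)

text \<open>The recursion descends to \<open>F\<close>: at the root the claim is the relation in
  \<open>F\<close>, and one level down the pair has either become the section of \<open>r\<close> or
  is again a related pair, so the induction runs with \<open>s\<close>, \<open>t\<close>,
  \<open>r\<close> varying.\<close>

lemma act_mrg:
  assumes "mrg s t = Some r" "xs \<in> tree d"
  shows "act [s, t] xs = act r xs \<and> ev (sect [s, t] xs) = ev (sect r xs)"
  using assms
proof (induction xs arbitrary: s t r)
  case Nil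
  then show ?case using beta_mrg by simp
next
  case (Cons x xs)
  have x: "x < d" and xs: "xs \<in> tree d" using Cons.prems by auto
  have "act (wsec \<tau> \<delta> [s, t] x) xs = act (wsec \<tau> \<delta> r x) xs \<and>
      ev (sect (wsec \<tau> \<delta> [s, t] x) xs) = ev (sect (wsec \<tau> \<delta> r x) xs)"
    using wsec_mrg[OF Cons.prems(1) x] Cons.IH[OF _ xs] by metis
  then show ?case
    using wout_mrg[OF Cons.prems(1) x] by (simp only: out.simps sec.simps)
qed

definition winv :: "'s list \<Rightarrow> 's list" where
  "winv w = rev (map linv w)"

lemma winv_winv [simp]: "winv (winv w) = w"
  by (induction w) (auto simp: winv_def rev_map o_def)

text \<open>The last letter of \<open>w\<close> meets its inverse in the middle of
  \<open>w @ winv w\<close>, and \<open>mrg_linv\<close> deletes that pair; hence the induction from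
  the right end.\<close>

lemma act_winv:
  assumes "xs \<in> tree d"
  shows "act (w @ winv w) xs = xs \<and> ev (sect (w @ winv w) xs) = \<one>"
  using assms
proof (induction w arbitrary: xs rule: rev_induct)
  case (snoc s w)
  let ?y = "act (winv w) xs"
  have y: "?y \<in> tree d" using snoc.prems by (rule act_tree)
  have split: "(w @ [s]) @ winv (w @ [s]) = w @ [s, linv s] @ winv w"
    by (simp add: winv_def)
  have s: "act [s, linv s] ?y = ?y \<and> ev (sect [s, linv s] ?y) = \<one>"
    using act_mrg[OF mrg_linv y] by simp
  have "act ((w @ [s]) @ winv (w @ [s])) xs = act (w @ winv w) xs"
    unfolding split by (simp only: out_append s)
  moreover have "ev (sect ((w @ [s]) @ winv (w @ [s])) xs) = ev (sect (w @ winv w) xs)"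
    unfolding split by (simp only: out_append sec_append ev_append s F.l_one ev_closed)
  ultimately show ?case using snoc by metis
qed (simp add: winv_def)

section \<open>Contraction of words trivial on the tree\<close>

text \<open>Triviality on \<open>X^n x F\<close>: left translation by an element of \<open>F\<close>
  is the identity only for \<open>\<one>\<close>.\<close>

definition trivial_at :: "nat \<Rightarrow> 's list \<Rightarrow> bool" where
  "trivial_at n w \<longleftrightarrow> (\<forall>xs\<in>level d n. act w xs = xs \<and> ev (sect w xs) = \<one>)"

lemma length_sect_le:
  assumes "xs \<in> tree d"
  shows "length (sect [s] xs) \<le> 1"
proof -
  have "length (sect w xs) \<le> 1" if "length w \<le> 1" for w
    using that assms
  proof (induction xs arbitrary: w)
    case (Cons x xs)
    have "x < d" "xs \<in> tree d" using Cons.prems(2) by auto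
    moreover from this have "length (wsec \<tau> \<delta> w x) \<le> 1"
      using Cons.prems(1) length_section[of x "hd w"] by (cases w) auto
    ultimately show ?case using Cons.IH by simp
  qed simp
  then show ?thesis by simp
qed

text \<open>Cut \<open>w\<close> into consecutive pairs from the left. Each pair is met at the level
  \<open>k\<close> vertex to which the letters after it move \<open>xs\<close>, and leaves at most
  one letter there; so does a last unpaired letter, hence the rounding up.\<close>

lemma length_sect_halves:
  assumes "\<And>u s t v. w = u @ [s, t] @ v \<Longrightarrow> mrg s t = None" and "xs \<in> level d k"
  shows "length (sect w xs) \<le> (length w + 1) div 2"
  using assms(1)
proof (induction w rule: induct_list012)
  case (2 s)
  then show ?case using length_sect_le[OF level_imp_tree[OF assms(2)]] by simp
next
  case (3 s t w)
  have "mrg s t = None" using "3.prems"[of "[]" s t w] by simp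
  then have "length (sect [s, t] (act w xs)) \<le> 1"
    using no_mrg act_level[OF assms(2)] by blast
  moreover have "length (sect w xs) \<le> (length w + 1) div 2"
    using "3.IH"(1) "3.prems"[of "s # t # _"] by simp
  moreover have "length (sect (s # t # w) xs) = length (sect [s, t] (act w xs)) + length (sect w xs)"
    using sec_append[of \<tau> \<delta> "[s, t]" w xs] by simp
  ultimately show ?case by simp
qed simp

text \<open>A mergeable pair gives a shorter word with the same action and the same values in
  \<open>F\<close>. Otherwise the sections at level \<open>k\<close> inherit triviality on the tree
  and are shorter, since \<open>(l + 1) div 2 < l\<close> for \<open>2 \<le> l\<close>; there are
  finitely many of them, so one bound serves all.\<close>

lemma eventually_trivial_at:
  assumes "\<And>xs. xs \<in> tree d \<Longrightarrow> act w xs = xs"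
  shows "\<forall>\<^sub>F n in sequentially. trivial_at n w"
  using assms
proof (induction "length w" arbitrary: w rule: less_induct)
  case less
  consider "w = []" | s where "w = [s]"
    | u s t v r where "w = u @ [s, t] @ v" "mrg s t = Some r"
    | "2 \<le> length w" "\<And>u s t v. w = u @ [s, t] @ v \<Longrightarrow> mrg s t = None"
  proof -
    have "w = [] \<or> (\<exists>s. w = [s]) \<or> 2 \<le> length w"
      by (cases w; cases "tl w") auto
    then show ?thesis using that by (metis not_Some_eq)
  qed
  then show ?case
  proof cases
    case 1
    then show ?thesis by (simp add: trivial_at_def)
  next
    case 2
    then show ?thesis using letter_nontrivial less.prems by blast
  next
    case (3 u s t v r)
    have eq: "act w xs = act (u @ r @ v) xs \<and> ev (sect w xs) = ev (sect (u @ r @ v) xs)"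
      if "xs \<in> tree d" for xs
      using act_mrg[OF 3(2) act_tree[OF that, of v]]
      by (simp only: 3(1) out_append sec_append ev_append)
    have "length (u @ r @ v) < length w"
      using length_mrg[OF 3(2)] 3(1) by simp
    then have "\<forall>\<^sub>F n in sequentially. trivial_at n (u @ r @ v)"
      using less eq by metis
    then show ?thesis
      by eventually_elim (use eq level_imp_tree in \<open>simp add: trivial_at_def\<close>)
  next
    case 4
    have "\<forall>\<^sub>F n in sequentially. trivial_at n (sect w xs)" if xs: "xs \<in> level d k" for xs
    proof (rule less.hyps)
      show "length (sect w xs) < length w"
        using length_sect_halves[OF _ xs, of w] 4 by fastforce
      fix ys assume "ys \<in> tree d"
      then show "act (sect w xs) ys = ys"
        using less.prems[of "xs @ ys"] level_imp_tree[OF xs] out_append_path[of \<tau> \<delta> w xs ys] by simp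
    qed
    then have "\<forall>\<^sub>F n in sequentially. \<forall>xs\<in>level d k. trivial_at n (sect w xs)"
      using finite_level by (intro eventually_ball_finite) auto
    then have "\<forall>\<^sub>F n in sequentially. trivial_at (n + k) w"
    proof eventually_elim
      case (elim n)
      show ?case unfolding trivial_at_def
      proof
        fix zs assume zs: "zs \<in> level d (n + k)"
        have "take k zs \<in> level d k" "drop k zs \<in> level d n"
          using zs set_take_subset[of k zs] set_drop_subset[of k zs] by (auto simp: level_def)
        then have "ev (sect (sect w (take k zs)) (drop k zs)) = \<one>"
          using elim unfolding trivial_at_def by blast
        then show "act w zs = zs \<and> ev (sect w zs) = \<one>"
          using less.prems[OF level_imp_tree[OF zs]] sec_append_path[of \<tau> \<delta> w "take k zs" "drop k zs"]
          by simp
      qed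
    qed
    \<comment> \<open>The levels reached are \<open>n + k\<close>; a constant shift does not affect
      a claim about all large levels.\<close>
    then show ?thesis using eventually_sequentially_seg by blast
  qed
qed

section \<open>The permutation action on \<open>X^n x F\<close>\<close>

definition space :: "nat \<Rightarrow> (nat list \<times> 'f) set" where
  "space n = level d n \<times> carrier F"

text \<open>The n-fold wreath recursion as permutations, \<open>F\<close> acting on itself by left
  translation. It is indexed by words, not by elements of \<open>F\<close>, because contraction
  measures lengths; \<open>Bij\<close> demands the restriction.\<close>

definition \<kappa> :: "nat \<Rightarrow> 's list \<Rightarrow> nat list \<times> 'f \<Rightarrow> nat list \<times> 'f" where
  "\<kappa> n w = (\<lambda>(xs, f) \<in> space n. (act w xs, ev (sect w xs) \<otimes> f))"

definition tree_act :: "'s list \<Rightarrow> nat list \<Rightarrow> nat list" where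
  "tree_act w = restrict (act w) (tree d)"

lemma \<kappa>_apply:
  "\<lbrakk>xs \<in> level d n; f \<in> carrier F\<rbrakk> \<Longrightarrow> \<kappa> n w (xs, f) = (act w xs, ev (sect w xs) \<otimes> f)"
  by (simp add: \<kappa>_def space_def)

lemma \<kappa>_space: "z \<in> space n \<Longrightarrow> \<kappa> n w z \<in> space n"
  by (auto simp: \<kappa>_def space_def act_level)

lemma \<kappa>_append_apply: "z \<in> space n \<Longrightarrow> \<kappa> n (u @ w) z = \<kappa> n u (\<kappa> n w z)"
  by (auto simp: \<kappa>_def space_def act_level out_append sec_append ev_append F.m_assoc
      simp del: foldr_append)

lemma \<kappa>_winv_apply: "z \<in> space n \<Longrightarrow> \<kappa> n (w @ winv w) z = z"
  using act_winv[OF level_imp_tree] by (auto simp: \<kappa>_def space_def simp del: foldr_append)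

lemma \<kappa>_Bij: "\<kappa> n w \<in> Bij (space n)"
proof -
  have "bij_betw (\<kappa> n w) (space n) (space n)"
  proof (rule bij_betw_byWitness[where f' = "\<kappa> n (winv w)"])
    show "\<forall>z\<in>space n. \<kappa> n (winv w) (\<kappa> n w z) = z"
      using \<kappa>_winv_apply[of _ n "winv w"] by (simp add: \<kappa>_append_apply)
    show "\<forall>z\<in>space n. \<kappa> n w (\<kappa> n (winv w) z) = z"
      using \<kappa>_winv_apply[of _ n w] by (simp add: \<kappa>_append_apply)
  qed (use \<kappa>_space in auto)
  then show ?thesis by (simp add: Bij_def \<kappa>_def)
qed

lemma tree_act_Bij: "tree_act w \<in> Bij (tree d)"
proof -
  have inv: "act w (act (winv w) xs) = xs" if "xs \<in> tree d" for w xs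
    using act_winv[OF that, of w] by (simp add: out_append)
  have "bij_betw (act w) (tree d) (tree d)"
  proof (rule bij_betw_byWitness[where f' = "act (winv w)"])
    show "\<forall>xs\<in>tree d. act (winv w) (act w xs) = xs" using inv[of _ "winv w"] by simp
    show "\<forall>xs\<in>tree d. act w (act (winv w) xs) = xs" using inv[of _ w] by simp
  qed (use act_tree in blast)+
  then show ?thesis by (simp add: Bij_def tree_act_def)
qed

lemma \<kappa>_append: "\<kappa> n (u @ w) = \<kappa> n u \<otimes>\<^bsub>BijGroup (space n)\<^esub> \<kappa> n w"
proof
  fix z
  show "\<kappa> n (u @ w) z = (\<kappa> n u \<otimes>\<^bsub>BijGroup (space n)\<^esub> \<kappa> n w) z"
    by (cases "z \<in> space n") (simp_all add: BijGroup_def compose_def \<kappa>_Bij \<kappa>_append_apply,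
      simp add: \<kappa>_def)
qed

lemma \<kappa>_Nil: "\<kappa> n [] = \<one>\<^bsub>BijGroup (space n)\<^esub>"
  by (auto simp: BijGroup_def \<kappa>_def space_def fun_eq_iff)

lemma tree_act_append: "tree_act (u @ w) = tree_act u \<otimes>\<^bsub>BijGroup (tree d)\<^esub> tree_act w"
  using tree_act_Bij
  by (auto simp: BijGroup_def compose_def fun_eq_iff tree_act_def out_append act_tree)

lemma tree_act_Nil: "tree_act [] = \<one>\<^bsub>BijGroup (tree d)\<^esub>"
  by (auto simp: BijGroup_def tree_act_def fun_eq_iff)

lemma \<kappa>_eq_one: "trivial_at n w \<Longrightarrow> \<kappa> n w = \<one>\<^bsub>BijGroup (space n)\<^esub>"
  by (auto simp: BijGroup_def \<kappa>_def space_def fun_eq_iff trivial_at_def)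


text \<open>Applied to \<open>tree_act\<close> and to \<open>\<kappa> n\<close>: a group word in the
  elements given by \<open>W\<close> becomes a single letter word, inverted generators turning into
  \<open>winv\<close>. The same letter word thus tests a relator in both actions.\<close>

lemma word_eval_words:
  assumes "group M" and append: "\<And>u w. \<mu> (u @ w) = \<mu> u \<otimes>\<^bsub>M\<^esub> \<mu> w" and Nil: "\<mu> [] = \<one>\<^bsub>M\<^esub>"
    and closed: "\<And>w. \<mu> w \<in> carrier M" and winv: "\<And>w. \<mu> (w @ winv w) = \<one>\<^bsub>M\<^esub>"
  shows "word_eval M (\<lambda>i. \<mu> (W i)) r =
    \<mu> (concat (map (\<lambda>x. if fst x then W (snd x) else winv (W (snd x))) r))"
proof (induction r)
  case (Cons x r)
  interpret M: group M by fact
  have "inv\<^bsub>M\<^esub> \<mu> w = \<mu> (winv w)" for w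
    using M.inv_equality[of "\<mu> (winv w)" "\<mu> w"] winv[of "winv w"] by (simp add: append closed)
  then show ?case by (simp add: word_eval_Cons Cons append)
qed (simp add: Nil)

lemma word_eval_tree_act:
  "word_eval (BijGroup (tree d)) (\<lambda>i. tree_act (W i)) r =
    tree_act (concat (map (\<lambda>x. if fst x then W (snd x) else winv (W (snd x))) r))"
proof (rule word_eval_words)
  show "tree_act w \<in> carrier (BijGroup (tree d))" for w
    using tree_act_Bij by (simp add: BijGroup_def)
  show "tree_act (w @ winv w) = \<one>\<^bsub>BijGroup (tree d)\<^esub>" for w
    using act_winv by (auto simp: BijGroup_def tree_act_def fun_eq_iff)
qed (auto simp: group_BijGroup tree_act_append tree_act_Nil)

lemma \<kappa>_closed [simp]: "\<kappa> n w \<in> carrier (BijGroup (space n))"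
  using \<kappa>_Bij by (simp add: BijGroup_def)

lemma \<kappa>_winv: "\<kappa> n (w @ winv w) = \<one>\<^bsub>BijGroup (space n)\<^esub>"
  using act_winv[OF level_imp_tree]
  by (intro \<kappa>_eq_one) (simp add: trivial_at_def del: foldr_append)

lemma word_eval_\<kappa>:
  "word_eval (BijGroup (space n)) (\<lambda>i. \<kappa> n (W i)) r =
    \<kappa> n (concat (map (\<lambda>x. if fst x then W (snd x) else winv (W (snd x))) r))"
  by (rule word_eval_words) (auto intro: group_BijGroup \<kappa>_append \<kappa>_Nil \<kappa>_winv)

section \<open>Vertex stabilisers and large images\<close>

text \<open>Taking sections at a vertex is multiplicative on words that fix it, so single letters
  suffice at level 1; adding one \<open>0\<close> at a time reaches level \<open>n\<close>.\<close>

lemma self_replicating_level: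
  "\<exists>w. act w (replicate n 0) = replicate n 0 \<and> sect w (replicate n 0) = u"
proof (induction n arbitrary: u)
  case (Suc n)
  obtain w where w: "act w (replicate n 0) = replicate n 0" "sect w (replicate n 0) = u"
    using Suc by blast
  have "\<exists>w'. wout \<tau> w' 0 = 0 \<and> wsec \<tau> \<delta> w' 0 = w"
  proof (induction w)
    case Nil
    show ?case by (rule exI[of _ "[]"]) simp
  next
    case (Cons s w)
    then obtain v v' where "wout \<tau> v 0 = 0" "wsec \<tau> \<delta> v 0 = w" "wout \<tau> v' 0 = 0" "wsec \<tau> \<delta> v' 0 = [s]"
      using self_replicating by blast
    then show ?case by (intro exI[of _ "v' @ v"]) (simp add: wout_append wsec_append)
  qed
  then obtain w' where "wout \<tau> w' 0 = 0" "wsec \<tau> \<delta> w' 0 = w" by blast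
  then show ?case using w by (intro exI[of _ w']) simp
qed auto

text \<open>Following the single point \<open>(v, \<one>)\<close> is enough: the permutations
  commute with right translations of \<open>F\<close>, so on the elements keeping the fibre over
  \<open>v\<close> its second coordinate is a homomorphism to \<open>F\<close>.\<close>

lemma large_if_epi_space:
  fixes \<Gamma> :: "('a, 'c) monoid_scheme"
  assumes "group \<Gamma>" and \<Phi>: "\<Phi> \<in> hom \<Gamma> (BijGroup (space n))"
    and im: "\<Phi> ` carrier \<Gamma> = range (\<kappa> n)"
  shows "large \<Gamma>"
proof -
  interpret \<Phi>: group_hom \<Gamma> "BijGroup (space n)" \<Phi>
    using assms(1) \<Phi> group_BijGroup by (simp add: group_hom_def group_hom_axioms_def)
  interpret N: subgroup N F by (rule N_subgroup)
  define v :: "nat list" where "v = replicate n 0"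
  have v: "v \<in> level d n" using d_pos by (auto simp: v_def level_def)
  define P where "P \<gamma> = \<Phi> \<gamma> (v, \<one>)" for \<gamma>
  define H where "H = {\<gamma> \<in> carrier \<Gamma>. fst (P \<gamma>) = v \<and> snd (P \<gamma>) \<in> N}"
  have "\<exists>w. \<Phi> \<gamma> = \<kappa> n w" if "\<gamma> \<in> carrier \<Gamma>" for \<gamma>
    using im that by blast
  then obtain wd where wd: "\<Phi> \<gamma> = \<kappa> n (wd \<gamma>)" if "\<gamma> \<in> carrier \<Gamma>" for \<gamma>
    by metis
  have P: "P \<gamma> = (act (wd \<gamma>) v, ev (sect (wd \<gamma>) v))" if "\<gamma> \<in> carrier \<Gamma>" for \<gamma>
    using that v by (simp add: P_def wd \<kappa>_apply)
  have P_mult: "P (\<gamma> \<otimes>\<^bsub>\<Gamma>\<^esub> \<gamma>') = \<Phi> \<gamma> (P \<gamma>')" if "\<gamma> \<in> carrier \<Gamma>" "\<gamma>' \<in> carrier \<Gamma>" for \<gamma> \<gamma>'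
  proof -
    have "\<Phi> (\<gamma> \<otimes>\<^bsub>\<Gamma>\<^esub> \<gamma>') = \<kappa> n (wd \<gamma> @ wd \<gamma>')"
      using that \<Phi>.hom_mult[OF that] by (simp only: wd \<kappa>_append)
    then show ?thesis
      using that v \<kappa>_append_apply[of "(v, \<one>)" n "wd \<gamma>" "wd \<gamma>'"]
      by (simp add: P_def wd space_def)
  qed
  have P_one: "P \<one>\<^bsub>\<Gamma>\<^esub> = (v, \<one>)"
    using v by (simp add: P_def BijGroup_def space_def)
  have P_mult_H: "P (\<gamma> \<otimes>\<^bsub>\<Gamma>\<^esub> \<gamma>') = (v, snd (P \<gamma>) \<otimes> snd (P \<gamma>'))" if "\<gamma> \<in> H" "\<gamma>' \<in> H" for \<gamma> \<gamma>'
  proof -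
    have \<gamma>: "\<gamma> \<in> carrier \<Gamma>" "\<gamma>' \<in> carrier \<Gamma>" "P \<gamma>' = (v, snd (P \<gamma>'))" "act (wd \<gamma>) v = v"
        "snd (P \<gamma>) = ev (sect (wd \<gamma>) v)" "snd (P \<gamma>') \<in> carrier F"
      using that P[of \<gamma>] by (auto simp: H_def prod_eq_iff)
    have "P (\<gamma> \<otimes>\<^bsub>\<Gamma>\<^esub> \<gamma>') = \<kappa> n (wd \<gamma>) (v, snd (P \<gamma>'))"
      using P_mult[OF \<gamma>(1,2)] wd[OF \<gamma>(1)] \<gamma>(3) by simp
    also have "\<dots> = (v, snd (P \<gamma>) \<otimes> snd (P \<gamma>'))"
      using \<gamma>(4-6) v by (simp add: \<kappa>_apply)
    finally show ?thesis .
  qed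
  \<comment> \<open>If the inverse of \<open>\<gamma>\<close> and \<open>\<gamma>'\<close> carry the
    base point into the same fibre, \<open>\<gamma>\<close> brings that fibre back over
    \<open>v\<close>, and its translation there is determined by the inverse of
    \<open>\<gamma>\<close>. Both closure of \<open>H\<close> under inverses and finite index
    follow.\<close>
  have P_inv_mult: "fst (P (\<gamma> \<otimes>\<^bsub>\<Gamma>\<^esub> \<gamma>')) = v \<and>
      snd (P (\<gamma> \<otimes>\<^bsub>\<Gamma>\<^esub> \<gamma>')) = inv (snd (P (inv\<^bsub>\<Gamma>\<^esub> \<gamma>))) \<otimes> snd (P \<gamma>')"
    if \<gamma>: "\<gamma> \<in> carrier \<Gamma>" "\<gamma>' \<in> carrier \<Gamma>" and eq: "fst (P (inv\<^bsub>\<Gamma>\<^esub> \<gamma>)) = fst (P \<gamma>')" for \<gamma> \<gamma>'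
  proof -
    let ?x = "fst (P \<gamma>')" and ?f = "snd (P (inv\<^bsub>\<Gamma>\<^esub> \<gamma>))"
    have x: "?x \<in> level d n" and f: "?f \<in> carrier F" "snd (P \<gamma>') \<in> carrier F"
      using \<gamma> v by (simp_all add: P act_level)
    have "\<Phi> \<gamma> (P (inv\<^bsub>\<Gamma>\<^esub> \<gamma>)) = (v, \<one>)"
      using P_mult[of \<gamma> "inv\<^bsub>\<Gamma>\<^esub> \<gamma>"] \<gamma> P_one by simp
    then have "\<kappa> n (wd \<gamma>) (?x, ?f) = (v, \<one>)"
      using wd \<gamma> eq by (metis prod.collapse)
    then have a: "act (wd \<gamma>) ?x = v" and e: "ev (sect (wd \<gamma>) ?x) \<otimes> ?f = \<one>"
      using x f by (simp_all add: \<kappa>_apply)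
    have "ev (sect (wd \<gamma>) ?x) = inv ?f"
      using F.inv_equality[OF e] f by simp
    moreover have "P (\<gamma> \<otimes>\<^bsub>\<Gamma>\<^esub> \<gamma>') = \<kappa> n (wd \<gamma>) (?x, snd (P \<gamma>'))"
      using P_mult[OF \<gamma>] wd \<gamma> by simp
    ultimately show ?thesis
      using \<kappa>_apply[OF x f(2), of "wd \<gamma>"] a by (simp del: prod.collapse)
  qed
  have H: "subgroup H \<Gamma>"
  proof (rule \<Phi>.G.subgroupI)
    show "H \<noteq> {}"
      using P_one \<Phi>.G.one_closed N.one_closed unfolding H_def by fastforce
    fix \<gamma> assume \<gamma>: "\<gamma> \<in> H"
    have "fst (P (inv\<^bsub>\<Gamma>\<^esub> \<gamma> \<otimes>\<^bsub>\<Gamma>\<^esub> \<one>\<^bsub>\<Gamma>\<^esub>)) = v \<and>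
      snd (P (inv\<^bsub>\<Gamma>\<^esub> \<gamma> \<otimes>\<^bsub>\<Gamma>\<^esub> \<one>\<^bsub>\<Gamma>\<^esub>)) = inv (snd (P (inv\<^bsub>\<Gamma>\<^esub> (inv\<^bsub>\<Gamma>\<^esub> \<gamma>)))) \<otimes> snd (P \<one>\<^bsub>\<Gamma>\<^esub>)"
      using \<gamma> by (intro P_inv_mult) (auto simp: H_def P_one)
    then show "inv\<^bsub>\<Gamma>\<^esub> \<gamma> \<in> H" using \<gamma> by (simp add: H_def P_one)
  next
    fix \<gamma> \<gamma>' assume "\<gamma> \<in> H" "\<gamma>' \<in> H"
    then show "\<gamma> \<otimes>\<^bsub>\<Gamma>\<^esub> \<gamma>' \<in> H"
      using P_mult_H by (simp add: H_def)
  qed (auto simp: H_def)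
  have fin: "finite (rcosets\<^bsub>\<Gamma>\<^esub> H)"
  proof (rule finite_rcosets_if_finite_invariant[OF assms(1) H])
    \<comment> \<open>Right cosets of \<open>H\<close> correspond to images of the base point under
      inverses, which is why inverses occur in both components; equal values put
      \<open>inv ?f \<otimes> ?f'\<close> into \<open>N\<close>.\<close>
    let ?\<rho> = "\<lambda>\<gamma>. (fst (P (inv\<^bsub>\<Gamma>\<^esub> \<gamma>)), N #> inv (snd (P (inv\<^bsub>\<Gamma>\<^esub> \<gamma>))))"
    have "?\<rho> ` carrier \<Gamma> \<subseteq> level d n \<times> rcosets N"
      using v by (auto simp: P act_level intro!: F.rcosetsI N.subset)
    then show "finite (?\<rho> ` carrier \<Gamma>)"
      using finite_level N_finite_index by (meson finite_SigmaI finite_subset)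
    fix \<gamma> \<gamma>' assume \<gamma>: "\<gamma> \<in> carrier \<Gamma>" "\<gamma>' \<in> carrier \<Gamma>" and eq: "?\<rho> \<gamma> = ?\<rho> \<gamma>'"
    let ?f = "snd (P (inv\<^bsub>\<Gamma>\<^esub> \<gamma>))" and ?f' = "snd (P (inv\<^bsub>\<Gamma>\<^esub> \<gamma>'))"
    have f: "?f \<in> carrier F" "?f' \<in> carrier F" using \<gamma> by (simp_all add: P)
    have "inv ?f \<in> N #> inv ?f'"
      using F.rcos_self[OF _ N_subgroup, of "inv ?f"] f eq by simp
    then have "inv ?f \<otimes> ?f' \<in> N"
      using N.rcos_module_imp[OF F.is_group, of "inv ?f'" "inv ?f"] f by simp
    then show "\<gamma> \<otimes>\<^bsub>\<Gamma>\<^esub> inv\<^bsub>\<Gamma>\<^esub> \<gamma>' \<in> H"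
      using P_inv_mult[of \<gamma> "inv\<^bsub>\<Gamma>\<^esub> \<gamma>'"] \<gamma> eq by (simp add: H_def)
  qed
  have hom: "(\<lambda>\<gamma>. p (snd (P \<gamma>))) \<in> hom (\<Gamma>\<lparr>carrier := H\<rparr>) (free_grp I)"
  proof (rule homI)
    fix \<gamma> \<gamma>' assume "\<gamma> \<in> carrier (\<Gamma>\<lparr>carrier := H\<rparr>)" "\<gamma>' \<in> carrier (\<Gamma>\<lparr>carrier := H\<rparr>)"
    then have \<gamma>: "\<gamma> \<in> H" "\<gamma>' \<in> H" "snd (P \<gamma>) \<in> N" "snd (P \<gamma>') \<in> N" by (auto simp: H_def)
    show "p (snd (P \<gamma>)) \<in> carrier (free_grp I)"
      using p_hom \<gamma>(3) by (auto simp: hom_def)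
    show "p (snd (P (\<gamma> \<otimes>\<^bsub>\<Gamma>\<lparr>carrier := H\<rparr>\<^esub> \<gamma>'))) = p (snd (P \<gamma>)) \<otimes>\<^bsub>free_grp I\<^esub> p (snd (P \<gamma>'))"
      using P_mult_H[OF \<gamma>(1,2)] hom_mult[OF p_hom, of "snd (P \<gamma>)" "snd (P \<gamma>')"] \<gamma> by simp
  qed
  have "u \<in> (\<lambda>\<gamma>. p (snd (P \<gamma>))) ` H" if u: "u \<in> carrier (free_grp I)" for u
  proof -
    obtain w where w: "ev w \<in> N" "p (ev w) = u" using p_surj[OF u] by blast
    obtain w' where w': "act w' v = v" "sect w' v = w"
      using self_replicating_level unfolding v_def by blast
    have "\<kappa> n w' \<in> \<Phi> ` carrier \<Gamma>" unfolding im by (rule rangeI)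
    then obtain \<gamma> where \<gamma>: "\<gamma> \<in> carrier \<Gamma>" "\<Phi> \<gamma> = \<kappa> n w'" by (metis imageE)
    have "P \<gamma> = (v, ev w)" using w' v by (simp add: P_def \<gamma>(2) \<kappa>_apply)
    then have "\<gamma> \<in> H" "u = p (snd (P \<gamma>))" using \<gamma>(1) w by (simp_all add: H_def)
    then show ?thesis by (rule rev_image_eqI)
  qed
  moreover have "(\<lambda>\<gamma>. p (snd (P \<gamma>))) ` H \<subseteq> carrier (free_grp I)"
    using hom by (auto simp: hom_def)
  ultimately have onto: "(\<lambda>\<gamma>. p (snd (P \<gamma>))) ` H = carrier (free_grp I)" by blast
  obtain i j where "i \<in> I" "j \<in> I" "i \<noteq> j" using I_nontrivial by blast
  then show ?thesis by (rule large_if_epi_free_grp[OF assms(1) H fin hom onto])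
qed

section \<open>Finitely presented groups over a contracting group\<close>

theorem large_if_finitely_presented_epi:
  fixes \<Gamma> :: "('a, 'c) monoid_scheme"
  assumes "group \<Gamma>" and fp: "finitely_presented \<Gamma>"
    and \<phi>: "\<phi> \<in> hom \<Gamma> (BijGroup (tree d))" and im: "\<phi> ` carrier \<Gamma> = range tree_act"
  shows "large \<Gamma>"
proof -
  obtain m :: nat and g R where g: "g \<in> {..<m} \<rightarrow> carrier \<Gamma>"
    and R: "finite R" "R \<subseteq> carrier (free_grp {..<m})"
    and surj: "word_eval \<Gamma> g ` carrier (free_grp {..<m}) = carrier \<Gamma>"
    and ker: "kernel (free_grp {..<m}) \<Gamma> (word_eval \<Gamma> g) = normal_closure (free_grp {..<m}) R"
    using fp unfolding finitely_presented_def by blast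
  let ?L = "free_grp {..<m}"
  interpret \<phi>: group_hom \<Gamma> "BijGroup (tree d)" \<phi>
    using assms(1) \<phi> group_BijGroup by (simp add: group_hom_def group_hom_axioms_def)
  have evg: "group_hom ?L \<Gamma> (word_eval \<Gamma> g)"
    using \<phi>.G.word_eval_hom[OF g] assms(1) group_free_grp
    by (simp add: group_hom_def group_hom_axioms_def)
  have "\<forall>i\<in>{..<m}. \<exists>w. \<phi> (g i) = tree_act w" using im g by blast
  then obtain W where W: "\<phi> (g i) = tree_act (W i)" if "i < m" for i
    by (metis lessThan_iff)
  define cW where "cW r = concat (map (\<lambda>x. if fst x then W (snd x) else winv (W (snd x))) r)"
    for r :: "(bool \<times> nat) list"
  have \<phi>_eval: "\<phi> (word_eval \<Gamma> g r) = tree_act (cW r)" if r: "r \<in> carrier ?L" for r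
  proof -
    have r': "snd ` set r \<subseteq> {..<m}" using r by (simp add: carrier_free_grp)
    then have "\<phi> (word_eval \<Gamma> g r) = word_eval (BijGroup (tree d)) (\<phi> \<circ> g) r"
      using g by (intro hom_word_eval[OF \<phi>.group_hom_axioms]) auto
    also have "\<dots> = word_eval (BijGroup (tree d)) (\<lambda>i. tree_act (W i)) r"
      using r' by (induction r) (auto simp: word_eval_Cons W)
    finally show ?thesis by (simp add: word_eval_tree_act cW_def)
  qed
  have trivial: "\<forall>\<^sub>F n in sequentially. trivial_at n w"
    if "tree_act w = \<one>\<^bsub>BijGroup (tree d)\<^esub>" for w
  proof (rule eventually_trivial_at)
    fix xs assume "xs \<in> tree d"
    then show "act w xs = xs"
      using fun_cong[OF that, of xs] by (simp add: tree_act_def BijGroup_def)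
  qed
  have "\<forall>\<^sub>F n in sequentially. trivial_at n (cW r)" if r: "r \<in> R" for r
  proof (rule trivial)
    have rc: "r \<in> carrier ?L" using r R by blast
    have "r \<in> normal_closure ?L R"
    proof -
      interpret L: group ?L by (rule group_free_grp)
      have "r = \<one>\<^bsub>?L\<^esub> \<otimes>\<^bsub>?L\<^esub> r \<otimes>\<^bsub>?L\<^esub> inv\<^bsub>?L\<^esub> \<one>\<^bsub>?L\<^esub>" using rc by simp
      then show ?thesis unfolding normal_closure_def using r L.one_closed
        by (blast intro: generate.incl)
    qed
    then have "word_eval \<Gamma> g r = \<one>\<^bsub>\<Gamma>\<^esub>" using ker by (auto simp: kernel_def)
    then show "tree_act (cW r) = \<one>\<^bsub>BijGroup (tree d)\<^esub>" using \<phi>_eval[OF rc] by simp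
  qed
  then have ev_R: "\<forall>\<^sub>F n in sequentially. \<forall>r\<in>R. trivial_at n (cW r)"
    using R by (intro eventually_ball_finite) auto
  \<comment> \<open>This prepares surjectivity: \<open>s\<close> agrees on the tree with some
    \<open>cW (\<rho> s)\<close>, an equation tested below as triviality of
    \<open>cW (\<rho> s)\<close> followed by \<open>linv s\<close>.\<close>
  have "\<exists>r\<in>carrier ?L. tree_act (cW r) = tree_act [s]" for s
    using im surj \<phi>_eval by (metis (no_types, lifting) imageE rangeI)
  then obtain \<rho> where \<rho>: "\<rho> s \<in> carrier ?L" "tree_act (cW (\<rho> s)) = tree_act [s]" for s
    by metis
  have "\<forall>\<^sub>F n in sequentially. trivial_at n (cW (\<rho> s) @ [linv s])" for s
  proof (rule trivial)
    have "tree_act (cW (\<rho> s) @ [linv s]) = tree_act ([s] @ winv [s])"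
      by (simp only: tree_act_append \<rho>) (simp add: winv_def)
    also have "\<dots> = tree_act []"
      using act_winv[of _ "[s]"] by (auto simp: tree_act_def fun_eq_iff)
    finally show "tree_act (cW (\<rho> s) @ [linv s]) = \<one>\<^bsub>BijGroup (tree d)\<^esub>"
      by (simp add: tree_act_Nil)
  qed
  then have "\<forall>\<^sub>F n in sequentially. \<forall>s\<in>UNIV. trivial_at n (cW (\<rho> s) @ [linv s])"
    using finite_letters by (intro eventually_ball_finite) auto
  with ev_R have "\<forall>\<^sub>F n in sequentially. (\<forall>r\<in>R. trivial_at n (cW r)) \<and>
      (\<forall>s. trivial_at n (cW (\<rho> s) @ [linv s]))"
    by eventually_elim simp
  then obtain n where n: "\<And>r. r \<in> R \<Longrightarrow> trivial_at n (cW r)"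
      "\<And>s. trivial_at n (cW (\<rho> s) @ [linv s])"
    using eventually_happens'[OF sequentially_bot] by blast
  let ?K = "BijGroup (space n)"
  interpret K: group ?K by (rule group_BijGroup)
  have evK: "group_hom ?L ?K (word_eval ?K (\<lambda>i. \<kappa> n (W i)))"
    using K.word_eval_hom[of "\<lambda>i. \<kappa> n (W i)" "{..<m}"] group_free_grp K.is_group
    by (simp add: group_hom_def group_hom_axioms_def)
  have "R \<subseteq> kernel ?L ?K (word_eval ?K (\<lambda>i. \<kappa> n (W i)))"
    using R n(1) by (auto simp: kernel_def word_eval_\<kappa> cW_def[symmetric] \<kappa>_eq_one)
  then have "kernel ?L \<Gamma> (word_eval \<Gamma> g) \<subseteq> kernel ?L ?K (word_eval ?K (\<lambda>i. \<kappa> n (W i)))"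
    unfolding ker by (rule normal_closure_subset_kernel[OF evK])
  then obtain \<Phi> where \<Phi>: "\<Phi> \<in> hom \<Gamma> ?K"
    and \<Phi>_eval: "\<And>r. r \<in> carrier ?L \<Longrightarrow> \<Phi> (word_eval \<Gamma> g r) = \<kappa> n (cW r)"
    using hom_factors_through_epi[OF evg surj evK] by (auto simp: word_eval_\<kappa> cW_def)
  interpret \<Phi>: group_hom \<Gamma> ?K \<Phi>
    using assms(1) \<Phi> K.is_group by (simp add: group_hom_def group_hom_axioms_def)
  have "\<Phi> ` carrier \<Gamma> = range (\<kappa> n)"
  proof
    show "\<Phi> ` carrier \<Gamma> \<subseteq> range (\<kappa> n)"
      unfolding surj[symmetric] using \<Phi>_eval by auto
    have letter: "\<kappa> n [s] = \<Phi> (word_eval \<Gamma> g (\<rho> s))" for s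
    proof -
      have 1: "\<kappa> n (cW (\<rho> s)) \<otimes>\<^bsub>?K\<^esub> \<kappa> n [linv s] = \<one>\<^bsub>?K\<^esub>"
        using \<kappa>_eq_one[OF n(2)] by (simp add: \<kappa>_append)
      have 2: "\<kappa> n [s] \<otimes>\<^bsub>?K\<^esub> \<kappa> n [linv s] = \<one>\<^bsub>?K\<^esub>"
        using \<kappa>_winv[of n "[s]"] \<kappa>_append[of n "[s]" "[linv s]"] by (simp add: winv_def)
      \<comment> \<open>Both sides are the inverse of \<open>\<kappa> n [linv s]\<close>.\<close>
      have "\<kappa> n [s] = \<kappa> n (cW (\<rho> s))"
        using K.inv_equality[OF 1] K.inv_equality[OF 2] by simp
      then show ?thesis using \<Phi>_eval \<rho> by simp
    qed
    have "\<kappa> n w \<in> \<Phi> ` carrier \<Gamma>" for w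
    proof (induction w)
      case Nil
      show ?case using \<Phi>.hom_one \<phi>.G.one_closed unfolding \<kappa>_Nil by (metis imageI)
    next
      case (Cons s w)
      then obtain \<gamma> where "\<gamma> \<in> carrier \<Gamma>" "\<kappa> n w = \<Phi> \<gamma>" by blast
      moreover have "word_eval \<Gamma> g (\<rho> s) \<in> carrier \<Gamma>" using surj \<rho> by blast
      ultimately show ?case
        using \<kappa>_append[of n "[s]" w] letter[of s]
        by (auto intro!: image_eqI[of _ _ "word_eval \<Gamma> g (\<rho> s) \<otimes>\<^bsub>\<Gamma>\<^esub> \<gamma>"])
    qed
    then show "range (\<kappa> n) \<subseteq> \<Phi> ` carrier \<Gamma>" by blast
  qed
  then show ?thesis by (rule large_if_epi_space[OF assms(1) \<Phi>])
qed

section \<open>Identification with the generated tree groups\<close>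

text \<open>The two groups modelled on \<open>C3 * C3\<close> name only \<open>a\<close> and
  \<open>b\<close> as generators; letters outside \<open>S\<close> are reached as inverses of
  letters in \<open>S\<close>.\<close>

lemma carrier_tree_group:
  assumes gens: "(\<lambda>f. restrict f (tree d)) ` gens = (\<lambda>s. tree_act [s]) ` S"
    and S: "\<And>s. s \<in> S \<or> linv s \<in> S"
  shows "carrier (tree_group d gens) = range tree_act"
proof -
  let ?B = "BijGroup (tree d)"
  interpret B: group ?B by (rule group_BijGroup)
  have closed: "tree_act w \<in> carrier ?B" for w
    using tree_act_Bij by (simp add: BijGroup_def)
  have inv: "inv\<^bsub>?B\<^esub> tree_act [s] = tree_act [linv s]" for s
  proof (rule B.inv_equality)
    have "tree_act ([linv s] @ winv [linv s]) = tree_act []"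
      using act_winv[of _ "[linv s]"] by (auto simp: tree_act_def fun_eq_iff)
    then show "tree_act [linv s] \<otimes>\<^bsub>?B\<^esub> tree_act [s] = \<one>\<^bsub>?B\<^esub>"
      using tree_act_append[of "[linv s]" "[s]"] by (simp add: winv_def tree_act_Nil)
  qed (rule closed)+
  have "generate ?B ((\<lambda>s. tree_act [s]) ` S) = range tree_act"
  proof (intro equalityI subsetI)
    fix f assume "f \<in> generate ?B ((\<lambda>s. tree_act [s]) ` S)"
    then show "f \<in> range tree_act"
      by (induction rule: generate.induct)
        (auto simp: inv tree_act_Nil[symmetric] tree_act_append[symmetric])
  next
    fix f assume "f \<in> range tree_act"
    then obtain w where f: "f = tree_act w" by blast
    have letter: "tree_act [s] \<in> generate ?B ((\<lambda>s. tree_act [s]) ` S)" for s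
    proof (cases "s \<in> S")
      case False
      then have "inv\<^bsub>?B\<^esub> tree_act [linv s] \<in> generate ?B ((\<lambda>s. tree_act [s]) ` S)"
        using S[of s] by (auto intro: generate.inv)
      then show ?thesis by (simp add: inv)
    qed (auto intro: generate.incl)
    show "f \<in> generate ?B ((\<lambda>s. tree_act [s]) ` S)"
      unfolding f
    proof (induction w)
      case Nil
      show ?case unfolding tree_act_Nil by (rule generate.one)
    next
      case (Cons s w)
      then show ?case
        using tree_act_append[of "[s]" w] letter[of s] by (auto intro: generate.eng)
    qed
  qed
  then show ?thesis by (simp add: tree_group_def gens)
qed

lemma large_if_epi_tree_group:
  fixes \<Gamma> :: "('a, 'c) monoid_scheme"
  assumes "group \<Gamma>" "finitely_presented \<Gamma>"
    and \<phi>: "\<phi> \<in> hom \<Gamma> (tree_group d gens)" "\<phi> ` carrier \<Gamma> = carrier (tree_group d gens)"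
    and gens: "(\<lambda>f. restrict f (tree d)) ` gens = (\<lambda>s. tree_act [s]) ` S"
      "\<And>s. s \<in> S \<or> linv s \<in> S"
  shows "large \<Gamma>"
proof (rule large_if_finitely_presented_epi[OF assms(1,2)])
  have im: "carrier (tree_group d gens) = range tree_act"
    by (rule carrier_tree_group[OF gens])
  then show "\<phi> ` carrier \<Gamma> = range tree_act" using \<phi>(2) by simp
  have "carrier (tree_group d gens) \<subseteq> carrier (BijGroup (tree d))"
    using im tree_act_Bij by (auto simp: BijGroup_def)
  then show "\<phi> \<in> hom \<Gamma> (BijGroup (tree d))"
    using \<phi>(1) by (auto simp: hom_def tree_group_def)
qed

end

section \<open>Extensions of the free group of rank two by a cyclic group\<close>

text \<open>The pair \<open>(u, k)\<close> stands for \<open>u a^k\<close>, where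
  \<open>a^q = 1\<close> and conjugation by \<open>a\<close> is \<open>\<sigma>\<close>.\<close>

definition semidirect :: "('a, 'm) monoid_scheme \<Rightarrow> ('a \<Rightarrow> 'a) \<Rightarrow> nat \<Rightarrow> ('a \<times> nat) monoid" where
  "semidirect L \<sigma> q =
     \<lparr>carrier = carrier L \<times> {..<q},
      monoid.mult = (\<lambda>(u, k) (v, l). (u \<otimes>\<^bsub>L\<^esub> (\<sigma> ^^ k) v, (k + l) mod q)),
      one = (\<one>\<^bsub>L\<^esub>, 0)\<rparr>"

lemma funpow_hom: "\<sigma> \<in> hom L L \<Longrightarrow> \<sigma> ^^ k \<in> hom L L"
proof (induction k)
  case 0
  then show ?case by (simp add: hom_def)
next
  case (Suc k)
  then show ?case by (auto simp: hom_def Pi_def)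
qed

locale cyclic_extension = L: group L for L :: "('a, 'm) monoid_scheme" +
  fixes \<sigma> :: "'a \<Rightarrow> 'a" and q :: nat
  assumes sigma_hom: "\<sigma> \<in> hom L L" and q_pos: "0 < q"
    and sigma_power: "u \<in> carrier L \<Longrightarrow> (\<sigma> ^^ q) u = u"
begin

abbreviation E :: "('a \<times> nat) monoid" where
  "E \<equiv> semidirect L \<sigma> q"

lemma funpow_closed: "u \<in> carrier L \<Longrightarrow> (\<sigma> ^^ k) u \<in> carrier L"
  using funpow_hom[OF sigma_hom] by (auto simp: hom_def)

lemma funpow_mod: "u \<in> carrier L \<Longrightarrow> (\<sigma> ^^ (k mod q)) u = (\<sigma> ^^ k) u"
proof (induction k rule: less_induct)
  case (less k)
  show ?case
  proof (cases "k < q")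
    case False
    then have "(\<sigma> ^^ k) u = (\<sigma> ^^ (k - q)) ((\<sigma> ^^ q) u)"
      by (simp flip: funpow_add[THEN fun_cong, unfolded o_apply])
    then show ?thesis
      using False less q_pos by (simp add: sigma_power le_mod_geq)
  qed simp
qed

lemma funpow_mult:
  "\<lbrakk>u \<in> carrier L; v \<in> carrier L\<rbrakk> \<Longrightarrow> (\<sigma> ^^ k) (u \<otimes>\<^bsub>L\<^esub> v) = (\<sigma> ^^ k) u \<otimes>\<^bsub>L\<^esub> (\<sigma> ^^ k) v"
  using funpow_hom[OF sigma_hom] by (auto simp: hom_def)

lemma funpow_one: "(\<sigma> ^^ k) \<one>\<^bsub>L\<^esub> = \<one>\<^bsub>L\<^esub>"
  using hom_one[OF funpow_hom[OF sigma_hom] L.is_group L.is_group] .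

lemma group_semidirect: "group E"
proof (rule groupI)
  fix x y z assume "x \<in> carrier E" "y \<in> carrier E" "z \<in> carrier E"
  then show "x \<otimes>\<^bsub>E\<^esub> y \<otimes>\<^bsub>E\<^esub> z = x \<otimes>\<^bsub>E\<^esub> (y \<otimes>\<^bsub>E\<^esub> z)"
    by (auto simp: semidirect_def funpow_closed funpow_mult funpow_mod L.m_assoc funpow_add
        mod_simps add.assoc)
next
  fix x assume "x \<in> carrier E"
  then obtain u k where x: "x = (u, k)" "u \<in> carrier L" "k < q" by (auto simp: semidirect_def)
  \<comment> \<open>The exponent \<open>-k\<close> modulo \<open>q\<close>; the outer
    \<open>mod\<close> matters for \<open>k = 0\<close>.\<close>
  let ?l = "(q - k) mod q"
  have "((\<sigma> ^^ ?l) (inv\<^bsub>L\<^esub> u), ?l) \<otimes>\<^bsub>E\<^esub> x = \<one>\<^bsub>E\<^esub>"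
    using x funpow_mult[of "inv\<^bsub>L\<^esub> u" u ?l] by (simp add: semidirect_def funpow_one mod_simps)
  moreover have "((\<sigma> ^^ ?l) (inv\<^bsub>L\<^esub> u), ?l) \<in> carrier E"
    using x q_pos by (simp add: semidirect_def funpow_closed)
  ultimately show "\<exists>y\<in>carrier E. y \<otimes>\<^bsub>E\<^esub> x = \<one>\<^bsub>E\<^esub>" by blast
qed (use q_pos in \<open>auto simp: semidirect_def funpow_closed\<close>)

lemma snd_inv: "y \<in> carrier E \<Longrightarrow> (snd y + snd (inv\<^bsub>E\<^esub> y)) mod q = 0"
  using group.r_inv[OF group_semidirect, of y]
  by (auto simp: semidirect_def split_beta prod_eq_iff)

lemma subgroup_base: "subgroup (carrier L \<times> {0}) E"
proof (rule group.subgroupI[OF group_semidirect])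
  fix x :: "'a \<times> nat" assume x: "x \<in> carrier L \<times> {0}"
  then have "x \<in> carrier E" using q_pos by (auto simp: semidirect_def)
  then have "inv\<^bsub>E\<^esub> x \<in> carrier E" "(snd x + snd (inv\<^bsub>E\<^esub> x)) mod q = 0"
    using group.inv_closed[OF group_semidirect] snd_inv by blast+
  then show "inv\<^bsub>E\<^esub> x \<in> carrier L \<times> {0}"
    using x by (auto simp: semidirect_def)
qed (use q_pos in \<open>auto simp: semidirect_def\<close>)

lemma finite_index_base: "finite (rcosets\<^bsub>E\<^esub> (carrier L \<times> {0}))"
proof (rule finite_rcosets_if_finite_invariant[OF group_semidirect subgroup_base])
  show "finite (snd ` carrier E)"
    by (rule finite_subset[of _ "{..<q}"]) (auto simp: semidirect_def)
  fix x y assume x: "x \<in> carrier E" and y: "y \<in> carrier E" and eq: "snd x = snd y"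
  interpret E: group E by (rule group_semidirect)
  have "x \<otimes>\<^bsub>E\<^esub> inv\<^bsub>E\<^esub> y \<in> carrier E" using x y by simp
  moreover have "snd (x \<otimes>\<^bsub>E\<^esub> inv\<^bsub>E\<^esub> y) = 0"
    using snd_inv[OF y] eq by (simp add: semidirect_def split_beta)
  ultimately show "x \<otimes>\<^bsub>E\<^esub> inv\<^bsub>E\<^esub> y \<in> carrier L \<times> {0}"
    by (auto simp: semidirect_def mem_Times_iff)
qed

lemma fst_hom_base: "fst \<in> hom (E\<lparr>carrier := carrier L \<times> {0}\<rparr>) L"
  by (auto simp: hom_def semidirect_def)

end

lemma word_eval_cong:
  "(\<And>i. i \<in> snd ` set w \<Longrightarrow> g i = g' i) \<Longrightarrow> word_eval G g w = word_eval G g' w"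
  by (induction w) (auto simp: word_eval_Cons)

lemma hom_free_grp_eqI:
  assumes "group G" "h \<in> hom (free_grp A) G" "h' \<in> hom (free_grp A) G"
    and "\<And>i. i \<in> A \<Longrightarrow> h [(True, i)] = h' [(True, i)]" and w: "w \<in> carrier (free_grp A)"
  shows "h w = h' w"
proof -
  have "snd ` set w \<subseteq> A" using w by (simp add: carrier_free_grp)
  then have "word_eval G (\<lambda>i. h [(True, i)]) w = word_eval G (\<lambda>i. h' [(True, i)]) w"
    using assms(4) by (intro word_eval_cong) blast
  then show ?thesis
    using assms(1-3) w by (simp add: hom_free_grp_eq_word_eval)
qed

abbreviation L2 :: "(bool \<times> nat) list monoid" where
  "L2 \<equiv> free_grp {..<2}"

lemma two_letters: "\<exists>i\<in>{..<2 :: nat}. \<exists>j\<in>{..<2}. i \<noteq> j"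
  by (intro bexI[of _ 0] bexI[of _ 1]) auto

text \<open>This supplies \<open>p_surj\<close>. Elements with second coordinate 0 multiply as in
  \<open>L2\<close>, so one-letter words suffice; both signs are given, since letter words are
  evaluated without inversion.\<close>

lemma base_letters_surj:
  assumes "cyclic_extension L2 \<sigma> q" and \<beta>: "\<And>s. \<beta> s \<in> carrier (semidirect L2 \<sigma> q)"
    and letters: "\<And>x. snd x < 2 \<Longrightarrow>
      \<exists>w. foldr (\<lambda>s f. \<beta> s \<otimes>\<^bsub>semidirect L2 \<sigma> q\<^esub> f) w \<one>\<^bsub>semidirect L2 \<sigma> q\<^esub> = ([x], 0)"
    and u: "u \<in> carrier L2"
  shows "\<exists>w. foldr (\<lambda>s f. \<beta> s \<otimes>\<^bsub>semidirect L2 \<sigma> q\<^esub> f) w \<one>\<^bsub>semidirect L2 \<sigma> q\<^esub> \<in> carrier L2 \<times> {0} \<and>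
    fst (foldr (\<lambda>s f. \<beta> s \<otimes>\<^bsub>semidirect L2 \<sigma> q\<^esub> f) w \<one>\<^bsub>semidirect L2 \<sigma> q\<^esub>) = u"
proof -
  interpret cyclic_extension L2 \<sigma> q by fact
  let ?ev = "\<lambda>w. foldr (\<lambda>s f. \<beta> s \<otimes>\<^bsub>E\<^esub> f) w \<one>\<^bsub>E\<^esub>"
  have "\<exists>w. ?ev w = (u, 0)" using u
  proof (induction u)
    case Nil
    show ?case by (rule exI[of _ "[]"]) (simp add: semidirect_def one_free_grp)
  next
    case (Cons x u)
    note c = free_grp_Cons[OF Cons.prems]
    have "snd x < 2" using c(1) by (auto simp: carrier_free_grp)
    then obtain v w where "?ev v = ([x], 0)" "?ev w = (u, 0)"
      using letters Cons.IH[OF c(2)] by blast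
    then have "?ev (v @ w) = ([x] \<otimes>\<^bsub>L2\<^esub> u, 0)"
      by (simp only: group.foldr_mult_append[OF group_semidirect \<beta>]) (simp add: semidirect_def)
    then show ?case using c(3) by metis
  qed
  then obtain w where "?ev w = (u, 0)" by blast
  then show ?thesis using u by (intro exI[of _ w]) simp
qed

text \<open>The group \<open>C\<^sub>2 * C\<^sub>2 * C\<^sub>2\<close>: its subgroup of words of even length is free on \<open>ba\<close> and
  \<open>ca\<close>, and conjugation by \<open>a\<close> inverts both.\<close>

datatype letter2 = La | Lb | Lc

definition mrg2 :: "letter2 \<Rightarrow> letter2 \<Rightarrow> letter2 list option" where
  "mrg2 s t = (if s = t then Some [] else None)"

definition \<sigma>2 :: "(bool \<times> nat) list \<Rightarrow> (bool \<times> nat) list" where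
  "\<sigma>2 = word_eval L2 (\<lambda>i. [(False, i)])"

text \<open>Normal forms \<open>u a^k\<close>: with \<open>x = ba\<close>, \<open>y = ca\<close> and
  \<open>a^2 = 1\<close> one has \<open>b = xa\<close> and \<open>c = ya\<close>.\<close>

fun \<beta>2 :: "letter2 \<Rightarrow> (bool \<times> nat) list \<times> nat" where
  "\<beta>2 La = ([], 1)"
| "\<beta>2 Lb = ([(True, 0)], 1)"
| "\<beta>2 Lc = ([(True, 1)], 1)"

lemma \<sigma>2_hom: "\<sigma>2 \<in> hom L2 L2"
  unfolding \<sigma>2_def
  by (rule group.word_eval_hom[OF group_free_grp]) (auto simp: carrier_free_grp reduced_word_Cons)

lemma \<sigma>2_letter: "i < 2 \<Longrightarrow> \<sigma>2 [(e, i)] = [(\<not> e, i)]"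
  by (simp add: \<sigma>2_def word_eval_Cons mult_free_grp one_free_grp inv_free_grp carrier_free_grp
      reduced_word_Cons inv_word_def push_eq)

lemma \<sigma>2_Nil: "\<sigma>2 [] = []"
  by (simp add: \<sigma>2_def one_free_grp)

interpretation C2: cyclic_extension L2 \<sigma>2 2
proof -
  have "(\<sigma>2 ^^ 2) u = id u" if "u \<in> carrier L2" for u
    by (rule hom_free_grp_eqI[OF group_free_grp funpow_hom[OF \<sigma>2_hom] _ _ that])
      (auto simp: hom_def numeral_2_eq_2 \<sigma>2_letter[unfolded numeral_2_eq_2])
  then show "cyclic_extension L2 \<sigma>2 2"
    by (simp add: cyclic_extension_def cyclic_extension_axioms_def group_free_grp \<sigma>2_hom)
qed

interpretation C2: large_letters "semidirect L2 \<sigma>2 2" id mrg2 \<beta>2 "carrier L2 \<times> {0}" fst "{..<2}"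
proof -
  have fin: "finite (UNIV :: letter2 set)"
    by (rule finite_subset[of _ "{La, Lb, Lc}"]) (use letter2.exhaust in auto)
  have closed: "\<beta>2 s \<in> carrier C2.E" for s
    by (cases s) (auto simp: semidirect_def carrier_free_grp reduced_word_Cons)
  have mult: "\<beta>2 s \<otimes>\<^bsub>C2.E\<^esub> \<beta>2 s = \<one>\<^bsub>C2.E\<^esub>" for s
    by (cases s) (auto simp: semidirect_def mult_free_grp one_free_grp push_eq \<sigma>2_letter \<sigma>2_Nil)
  have letters: "\<exists>w. foldr (\<lambda>s f. \<beta>2 s \<otimes>\<^bsub>C2.E\<^esub> f) w \<one>\<^bsub>C2.E\<^esub> = ([x], 0)" if "snd x < 2" for x
  proof -
    have "x \<in> {(True, 0), (False, 0), (True, 1), (False, 1)}"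
      using that by (cases x) (auto simp: less_2_cases_iff)
    then consider "x = (True, 0)" | "x = (False, 0)" | "x = (True, 1)" | "x = (False, 1)"
      by blast
    \<comment> \<open>The basis elements are \<open>ba\<close> and \<open>ca\<close>, their inverses
      \<open>ab\<close> and \<open>ac\<close>.\<close>
    then show ?thesis
      by cases (rule exI[of _ "[Lb, La]"] exI[of _ "[La, Lb]"] exI[of _ "[Lc, La]"]
          exI[of _ "[La, Lc]"],
          simp add: semidirect_def mult_free_grp one_free_grp push_eq \<sigma>2_letter \<sigma>2_Nil)+
  qed
  show "large_letters C2.E id mrg2 \<beta>2 (carrier L2 \<times> {0}) fst {..<2}"
    by (intro large_letters.intro large_letters_axioms.intro C2.group_semidirect fin closed
        C2.subgroup_base C2.finite_index_base C2.fst_hom_base two_letters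
        base_letters_surj[OF C2.cyclic_extension_axioms closed letters])
      (auto simp: mrg2_def mult split: if_splits)
qed

text \<open>The group \<open>C\<^sub>3 * C\<^sub>3\<close>: the kernel of the homomorphism onto \<open>C\<^sub>3\<close> sending \<open>a\<close> and \<open>b\<close> to the
  same generator is free on \<open>x = ba\<inverse>\<close> and \<open>y = axa\<inverse>\<close>, and \<open>aya\<inverse> = (xy)\<inverse>\<close> because \<open>b\<^sup>3 = 1\<close>.
  The letters \<open>Rai\<close>, \<open>Rbi\<close> are the inverses of \<open>Ra\<close>, \<open>Rb\<close>, which stand for \<open>a\<close>, \<open>b\<close>.\<close>

datatype letter3 = Ra | Rai | Rb | Rbi

fun linv3 :: "letter3 \<Rightarrow> letter3" where
  "linv3 Ra = Rai" | "linv3 Rai = Ra" | "linv3 Rb = Rbi" | "linv3 Rbi = Rb"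

text \<open>As \<open>s^2\<close> is the inverse of \<open>s\<close>, every pair from one cyclic
  factor merges; a word without mergeable pairs alternates between the factors.\<close>

definition mrg3 :: "letter3 \<Rightarrow> letter3 \<Rightarrow> letter3 list option" where
  "mrg3 s t = (if s = t then Some [linv3 s] else if t = linv3 s then Some [] else None)"

definition \<sigma>3 :: "(bool \<times> nat) list \<Rightarrow> (bool \<times> nat) list" where
  "\<sigma>3 = word_eval L2 (\<lambda>i. if i = 0 then [(True, 1)] else [(False, 1), (False, 0)])"

text \<open>Normal forms \<open>u a^k\<close>: \<open>b = xa\<close>, and the inverse of
  \<open>b\<close> is \<open>b^2 = xaxa = xy a^2\<close>.\<close>

fun \<beta>3 :: "letter3 \<Rightarrow> (bool \<times> nat) list \<times> nat" where
  "\<beta>3 Ra = ([], 1)"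
| "\<beta>3 Rai = ([], 2)"
| "\<beta>3 Rb = ([(True, 0)], 1)"
| "\<beta>3 Rbi = ([(True, 0), (True, 1)], 2)"

lemma \<sigma>3_hom: "\<sigma>3 \<in> hom L2 L2"
  unfolding \<sigma>3_def
  by (rule group.word_eval_hom[OF group_free_grp]) (auto simp: carrier_free_grp reduced_word_Cons)

text \<open>\<open>\<sigma>3\<close> permutes \<open>x\<close>, \<open>y\<close> and the inverse of
  \<open>xy\<close> cyclically.\<close>

lemma \<sigma>3_words:
  "\<sigma>3 [] = []"
  "\<sigma>3 [(True, 0)] = [(True, 1)]"
  "\<sigma>3 [(True, Suc 0)] = [(False, 1), (False, 0)]"
  "\<sigma>3 [(False, Suc 0), (False, 0)] = [(True, 0)]"
  "\<sigma>3 [(True, 0), (True, Suc 0)] = [(False, 0)]"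
  "\<sigma>3 [(False, 0)] = [(False, 1)]"
  by (simp_all add: \<sigma>3_def word_eval_Cons mult_free_grp one_free_grp inv_free_grp carrier_free_grp
      reduced_word_Cons inv_word_def push_eq)

interpretation C3: cyclic_extension L2 \<sigma>3 3
proof -
  have "(\<sigma>3 ^^ 3) u = id u" if "u \<in> carrier L2" for u
    by (rule hom_free_grp_eqI[OF group_free_grp funpow_hom[OF \<sigma>3_hom] _ _ that])
      (auto simp: hom_def numeral_3_eq_3 less_2_cases_iff \<sigma>3_words)
  then show "cyclic_extension L2 \<sigma>3 3"
    by (simp add: cyclic_extension_def cyclic_extension_axioms_def group_free_grp \<sigma>3_hom)
qed

interpretation C3: large_letters "semidirect L2 \<sigma>3 3" linv3 mrg3 \<beta>3 "carrier L2 \<times> {0}" fst "{..<2}"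
proof -
  have fin: "finite (UNIV :: letter3 set)"
    by (rule finite_subset[of _ "{Ra, Rai, Rb, Rbi}"]) (use letter3.exhaust in auto)
  have closed: "\<beta>3 s \<in> carrier C3.E" for s
    by (cases s) (auto simp: semidirect_def carrier_free_grp reduced_word_Cons)
  note calc = semidirect_def mult_free_grp one_free_grp push_eq \<sigma>3_words numeral_2_eq_2
  have mult: "\<beta>3 s \<otimes>\<^bsub>C3.E\<^esub> \<beta>3 s = \<beta>3 (linv3 s) \<otimes>\<^bsub>C3.E\<^esub> \<one>\<^bsub>C3.E\<^esub>" 
      "\<beta>3 s \<otimes>\<^bsub>C3.E\<^esub> \<beta>3 (linv3 s) = \<one>\<^bsub>C3.E\<^esub>" for s
    by (cases s; simp add: calc)+
  have letters: "\<exists>w. foldr (\<lambda>s f. \<beta>3 s \<otimes>\<^bsub>C3.E\<^esub> f) w \<one>\<^bsub>C3.E\<^esub> = ([x], 0)" if "snd x < 2" for x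
  proof -
    have "x \<in> {(True, 0), (False, 0), (True, 1), (False, 1)}"
      using that by (cases x) (auto simp: less_2_cases_iff)
    then consider "x = (True, 0)" | "x = (False, 0)" | "x = (True, 1)" | "x = (False, 1)"
      by blast
    \<comment> \<open>\<open>x\<close> is \<open>b\<close> times the inverse of \<open>a\<close>;
      since \<open>a^3 = 1\<close>, \<open>y = axa^(-1)\<close> equals \<open>aba\<close>. The other
      two words are their inverses.\<close>
    then show ?thesis
      by cases (rule exI[of _ "[Rb, Rai]"] exI[of _ "[Ra, Rbi]"] exI[of _ "[Ra, Rb, Ra]"]
          exI[of _ "[Rai, Rbi, Rai]"], simp add: calc)+
  qed
  have linv: "linv3 (linv3 s) = s" "linv3 s \<noteq> s" for s by (cases s; simp)+
  show "large_letters C3.E linv3 mrg3 \<beta>3 (carrier L2 \<times> {0}) fst {..<2}"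
    by (intro large_letters.intro large_letters_axioms.intro C3.group_semidirect fin closed
        C3.subgroup_base C3.finite_index_base C3.fst_hom_base two_letters linv
        base_letters_surj[OF C3.cyclic_extension_axioms closed letters])
      (auto simp: mrg3_def mult linv linv(2)[symmetric] split: if_splits)
qed


section \<open>The four groups\<close>

lemma level_1E:
  assumes "xs \<in> level d 1"
  obtains x where "xs = [x]" "x < d"
  using assms by (cases xs) (auto simp: level_def)

lemma level_2E:
  assumes "xs \<in> level d 2"
  obtains x y where "xs = [x, y]" "x < d" "y < d"
  using assms by (cases xs; cases "tl xs") (auto simp: level_def)

lemma less_3_cases_iff: "x < 3 \<longleftrightarrow> x = 0 \<or> x = Suc 0 \<or> x = (2 :: nat)"
  by auto

section \<open>The group \<open>IMG(z^2+i)\<close>\<close>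

fun tauJ :: "letter2 \<Rightarrow> nat \<Rightarrow> nat" where
  "tauJ La x = (if x = 0 then 1 else 0)"
| "tauJ Lb x = x"
| "tauJ Lc x = x"

fun secJ :: "letter2 \<Rightarrow> nat \<Rightarrow> letter2 list" where
  "secJ La x = []"
| "secJ Lb x = (if x = 0 then [La] else [Lc])"
| "secJ Lc x = (if x = 0 then [Lb] else [])"

text \<open>A pair \<open>bc\<close> has a section \<open>ab\<close> of full length, which only shortens at the next level.\<close>

interpretation J: contracting_letters "semidirect L2 \<sigma>2 2" id mrg2 \<beta>2 "carrier L2 \<times> {0}" fst "{..<2}"
  2 2 tauJ secJ
proof
  show "tauJ s x < 2" "length (secJ s x) \<le> 1" if "x < 2" for s x
    using that by (cases s; simp)+
  show "wout tauJ [s, t] x = wout tauJ r x" if "mrg2 s t = Some r" "x < 2" for s t r x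
    using that by (cases s) (auto simp: mrg2_def less_2_cases_iff split: if_splits)
  show "wsec tauJ secJ [s, t] x = wsec tauJ secJ r x \<or>
      (\<exists>s' t'. wsec tauJ secJ [s, t] x = [s', t'] \<and> mrg2 s' t' = Some (wsec tauJ secJ r x))"
    if "mrg2 s t = Some r" "x < 2" for s t r x
    using that by (cases s) (auto simp: mrg2_def split: if_splits)
  show "length (sec tauJ secJ [s, t] xs) \<le> 1" if "mrg2 s t = None" "xs \<in> level 2 2" for s t xs
    using that(2)
    by (rule level_2E) (use that(1) in \<open>cases s; cases t; auto simp: mrg2_def less_2_cases_iff\<close>)
  \<comment> \<open>Depth 3 comes from \<open>c\<close>: its section at \<open>0\<close> is
    \<open>b\<close>, whose section at \<open>0\<close> is \<open>a\<close>, so it first moves the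
    third letter.\<close>
  show "\<exists>xs\<in>tree 2. out tauJ secJ [s] xs \<noteq> xs" for s
    by (rule bexI[of _ "[0, 0, 0]"]; cases s) auto
  \<comment> \<open>\<open>b\<close> and \<open>c\<close> have sections \<open>a\<close> and
    \<open>b\<close> at \<open>0\<close>; \<open>c\<close> is the section of \<open>b\<close> at
    \<open>1\<close>, moved to \<open>0\<close> by conjugation with \<open>a\<close>.\<close>
  show "\<exists>w. wout tauJ w 0 = 0 \<and> wsec tauJ secJ w 0 = [s]" for s
    by (cases s; rule exI[of _ "[Lb]"] exI[of _ "[Lc]"] exI[of _ "[La, Lb, La]"], simp)
qed simp

fun stateJ :: "letter2 \<Rightarrow> stJ" where
  "stateJ La = JA" | "stateJ Lb = JB" | "stateJ Lc = JC"

text \<open>Membership in the tree matters: \<open>tauJ La\<close> and \<open>actJ JA\<close> differ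
  on letters above 1.\<close>

lemma out_J: "xs \<in> tree 2 \<Longrightarrow> out tauJ secJ [s] xs = actJ (stateJ s) xs"
proof (induction xs arbitrary: s)
  case (Cons x xs)
  then show ?case by (cases s) (auto simp: less_2_cases_iff)
qed simp

lemma large_if_epi_IMG_J:
  fixes \<Gamma> :: "('a, 'c) monoid_scheme"
  assumes "group \<Gamma>" "finitely_presented \<Gamma>" "\<phi> \<in> hom \<Gamma> IMG_J" "\<phi> ` carrier \<Gamma> = carrier IMG_J"
  shows "large \<Gamma>"
proof (rule J.large_if_epi_tree_group[OF assms(1,2) assms(3,4)[unfolded IMG_J_def]])
  have "restrict (actJ (stateJ s)) (tree 2) = J.tree_act [s]" for s
    by (auto simp: J.tree_act_def out_J)
  from this[of La] this[of Lb] this[of Lc]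
  show "(\<lambda>f. restrict f (tree 2)) ` {actJ JA, actJ JB, actJ JC} = (\<lambda>s. J.tree_act [s]) ` {La, Lb, Lc}"
    by simp
  show "s \<in> {La, Lb, Lc} \<or> id s \<in> {La, Lb, Lc}" for s by (cases s) auto
qed

section \<open>The Hanoi Towers group\<close>

fun tauH :: "letter2 \<Rightarrow> nat \<Rightarrow> nat" where
  "tauH La x = (if x = 1 then 2 else if x = 2 then 1 else x)"
| "tauH Lb x = (if x = 0 then 2 else if x = 2 then 0 else x)"
| "tauH Lc x = (if x = 0 then 1 else if x = 1 then 0 else x)"

fun secH :: "letter2 \<Rightarrow> nat \<Rightarrow> letter2 list" where
  "secH La x = (if x = 0 then [La] else [])"
| "secH Lb x = (if x = 1 then [Lb] else [])"
| "secH Lc x = (if x = 2 then [Lc] else [])"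

interpretation H: contracting_letters "semidirect L2 \<sigma>2 2" id mrg2 \<beta>2 "carrier L2 \<times> {0}" fst "{..<2}"
  3 1 tauH secH
proof
  show "tauH s x < 3" "length (secH s x) \<le> 1" if "x < 3" for s x
    using that by (cases s; simp)+
  show "wout tauH [s, t] x = wout tauH r x" if "mrg2 s t = Some r" "x < 3" for s t r x
    using that by (cases s) (auto simp: mrg2_def split: if_splits)
  show "wsec tauH secH [s, t] x = wsec tauH secH r x \<or>
      (\<exists>s' t'. wsec tauH secH [s, t] x = [s', t'] \<and> mrg2 s' t' = Some (wsec tauH secH r x))"
    if "mrg2 s t = Some r" "x < 3" for s t r x
    using that by (cases s) (auto simp: mrg2_def split: if_splits)
  \<comment> \<open>A section is nonempty only at the peg its letter fixes, and distinct letters fix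
    distinct pegs.\<close>
  show "length (sec tauH secH [s, t] xs) \<le> 1" if "mrg2 s t = None" "xs \<in> level 3 1" for s t xs
    using that(2)
    by (rule level_1E) (use that(1) in \<open>cases s; cases t; auto simp: mrg2_def\<close>)
  show "\<exists>xs\<in>tree 3. out tauH secH [s] xs \<noteq> xs" for s
    by (cases s; rule bexI[of _ "[0]"] bexI[of _ "[1]"], simp, simp)
  \<comment> \<open>\<open>b\<close> and \<open>c\<close> keep their own section at the pegs
    \<open>1\<close> and \<open>2\<close>; conjugation by the letter exchanging that peg with
    \<open>0\<close> moves it there.\<close>
  show "\<exists>w. wout tauH w 0 = 0 \<and> wsec tauH secH w 0 = [s]" for s
    by (cases s; rule exI[of _ "[La]"] exI[of _ "[Lc, Lb, Lc]"] exI[of _ "[Lb, Lc, Lb]"], simp)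
qed simp

fun stateH :: "letter2 \<Rightarrow> stH" where
  "stateH La = HA" | "stateH Lb = HB" | "stateH Lc = HC"

lemma out_H: "xs \<in> tree 3 \<Longrightarrow> out tauH secH [s] xs = actH (stateH s) xs"
proof (induction xs arbitrary: s)
  case (Cons x xs)
  then show ?case by (cases s) auto
qed simp

lemma large_if_epi_Hanoi:
  fixes \<Gamma> :: "('a, 'c) monoid_scheme"
  assumes "group \<Gamma>" "finitely_presented \<Gamma>" "\<phi> \<in> hom \<Gamma> Hanoi" "\<phi> ` carrier \<Gamma> = carrier Hanoi"
  shows "large \<Gamma>"
proof (rule H.large_if_epi_tree_group[OF assms(1,2) assms(3,4)[unfolded Hanoi_def]])
  have "restrict (actH (stateH s)) (tree 3) = H.tree_act [s]" for s
    by (auto simp: H.tree_act_def out_H)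
  from this[of La] this[of Lb] this[of Lc]
  show "(\<lambda>f. restrict f (tree 3)) ` {actH HA, actH HB, actH HC} = (\<lambda>s. H.tree_act [s]) ` {La, Lb, Lc}"
    by simp
  show "s \<in> {La, Lb, Lc} \<or> id s \<in> {La, Lb, Lc}" for s by (cases s) auto
qed

section \<open>The Gupta-Sidki and Fabrykowski-Gupta groups\<close>

fun tau3 :: "letter3 \<Rightarrow> nat \<Rightarrow> nat" where
  "tau3 Ra x = (x + 1) mod 3"
| "tau3 Rai x = (x + 2) mod 3"
| "tau3 Rb x = x"
| "tau3 Rbi x = x"

fun secGS :: "letter3 \<Rightarrow> nat \<Rightarrow> letter3 list" where
  "secGS Ra x = []"
| "secGS Rai x = []"
| "secGS Rb x = (if x = 0 then [Ra] else if x = 1 then [Rai] else [Rb])"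
| "secGS Rbi x = (if x = 0 then [Rai] else if x = 1 then [Ra] else [Rbi])"

fun secFG :: "letter3 \<Rightarrow> nat \<Rightarrow> letter3 list" where
  "secFG Ra x = []"
| "secFG Rai x = []"
| "secFG Rb x = (if x = 0 then [Ra] else if x = 1 then [] else [Rb])"
| "secFG Rbi x = (if x = 0 then [Rai] else if x = 1 then [] else [Rbi])"

interpretation GS: contracting_letters "semidirect L2 \<sigma>3 3" linv3 mrg3 \<beta>3 "carrier L2 \<times> {0}" fst
  "{..<2}" 3 1 tau3 secGS
proof
  show "tau3 s x < 3" "length (secGS s x) \<le> 1" if "x < 3" for s x
    using that by (cases s; simp)+
  show "wout tau3 [s, t] x = wout tau3 r x" if "mrg3 s t = Some r" "x < 3" for s t r x
    using that by (cases s; cases t) (auto simp: mrg3_def less_3_cases_iff)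
  \<comment> \<open>The decisive pair is \<open>bb\<close>: its sections are the squares of
    \<open>a\<close>, of its inverse and of \<open>b\<close>, and each merges to the matching
    section of the inverse of \<open>b\<close>.\<close>
  show "wsec tau3 secGS [s, t] x = wsec tau3 secGS r x \<or>
      (\<exists>s' t'. wsec tau3 secGS [s, t] x = [s', t'] \<and> mrg3 s' t' = Some (wsec tau3 secGS r x))"
    if "mrg3 s t = Some r" "x < 3" for s t r x
    using that by (cases s; cases t) (auto simp: mrg3_def less_3_cases_iff)
  \<comment> \<open>An unmergeable pair contains one letter for a power of \<open>a\<close>, whose
    sections are empty.\<close>
  show "length (sec tau3 secGS [s, t] xs) \<le> 1" if "mrg3 s t = None" "xs \<in> level 3 1" for s t xs
    using that(2)
    by (rule level_1E) (use that(1) in \<open>cases s; cases t; auto simp: mrg3_def\<close>)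
  show "\<exists>xs\<in>tree 3. out tau3 secGS [s] xs \<noteq> xs" for s
    by (rule bexI[of _ "[0, 0]"]; cases s) auto
  \<comment> \<open>At \<open>0\<close> the letters for \<open>b\<close> and its inverse yield those
    for \<open>a\<close> and its inverse; conjugation by \<open>a\<close> brings their sections from
    \<open>2\<close> to \<open>0\<close>.\<close>
  show "\<exists>w. wout tau3 w 0 = 0 \<and> wsec tau3 secGS w 0 = [s]" for s
    by (cases s; rule exI[of _ "[Rb]"] exI[of _ "[Rbi]"] exI[of _ "[Ra, Rb, Rai]"]
        exI[of _ "[Ra, Rbi, Rai]"], simp)
qed simp

interpretation FG: contracting_letters "semidirect L2 \<sigma>3 3" linv3 mrg3 \<beta>3 "carrier L2 \<times> {0}" fst
  "{..<2}" 3 1 tau3 secFG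
proof
  show "tau3 s x < 3" "length (secFG s x) \<le> 1" if "x < 3" for s x
    using that by (cases s; simp)+
  show "wout tau3 [s, t] x = wout tau3 r x" if "mrg3 s t = Some r" "x < 3" for s t r x
    using GS.wout_mrg[OF that] .
  show "wsec tau3 secFG [s, t] x = wsec tau3 secFG r x \<or>
      (\<exists>s' t'. wsec tau3 secFG [s, t] x = [s', t'] \<and> mrg3 s' t' = Some (wsec tau3 secFG r x))"
    if "mrg3 s t = Some r" "x < 3" for s t r x
    using that by (cases s; cases t) (auto simp: mrg3_def less_3_cases_iff)
  show "length (sec tau3 secFG [s, t] xs) \<le> 1" if "mrg3 s t = None" "xs \<in> level 3 1" for s t xs
    using that(2)
    by (rule level_1E) (use that(1) in \<open>cases s; cases t; auto simp: mrg3_def\<close>)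
  show "\<exists>xs\<in>tree 3. out tau3 secFG [s] xs \<noteq> xs" for s
    by (rule bexI[of _ "[0, 0]"]; cases s) auto
  show "\<exists>w. wout tau3 w 0 = 0 \<and> wsec tau3 secFG w 0 = [s]" for s
    by (cases s; rule exI[of _ "[Rb]"] exI[of _ "[Rbi]"] exI[of _ "[Ra, Rb, Rai]"]
        exI[of _ "[Ra, Rbi, Rai]"], simp)
qed simp

text \<open>\<open>stGS\<close> has no state for the inverse of \<open>b\<close>, and none occurs
  among the sections of \<open>b\<close>; the three remaining letters are closed under sections and
  treated simultaneously.\<close>

lemma out_GS:
  "xs \<in> tree 3 \<Longrightarrow> out tau3 secGS [Ra] xs = actGS GA xs \<and> out tau3 secGS [Rai] xs = actGS GAi xs \<and>
    out tau3 secGS [Rb] xs = actGS GB xs"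
proof (induction xs)
  case (Cons x xs)
  then show ?case by auto
qed simp

lemma large_if_epi_Gupta_Sidki:
  fixes \<Gamma> :: "('a, 'c) monoid_scheme"
  assumes "group \<Gamma>" "finitely_presented \<Gamma>" "\<phi> \<in> hom \<Gamma> Gupta_Sidki"
    "\<phi> ` carrier \<Gamma> = carrier Gupta_Sidki"
  shows "large \<Gamma>"
proof (rule GS.large_if_epi_tree_group[OF assms(1,2) assms(3,4)[unfolded Gupta_Sidki_def]])
  have "restrict (actGS GA) (tree 3) = GS.tree_act [Ra]" "restrict (actGS GB) (tree 3) = GS.tree_act [Rb]"
    by (auto simp: GS.tree_act_def out_GS)
  then show "(\<lambda>f. restrict f (tree 3)) ` {actGS GA, actGS GB} = (\<lambda>s. GS.tree_act [s]) ` {Ra, Rb}"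
    by simp
  show "s \<in> {Ra, Rb} \<or> linv3 s \<in> {Ra, Rb}" for s by (cases s) auto
qed

lemma out_FG:
  "xs \<in> tree 3 \<Longrightarrow> out tau3 secFG [Ra] xs = actFG FA xs \<and> out tau3 secFG [Rb] xs = actFG FB xs"
proof (induction xs)
  case (Cons x xs)
  then show ?case by auto
qed simp

lemma large_if_epi_Fabrykowski_Gupta:
  fixes \<Gamma> :: "('a, 'c) monoid_scheme"
  assumes "group \<Gamma>" "finitely_presented \<Gamma>" "\<phi> \<in> hom \<Gamma> Fabrykowski_Gupta"
    "\<phi> ` carrier \<Gamma> = carrier Fabrykowski_Gupta"
  shows "large \<Gamma>"
proof (rule FG.large_if_epi_tree_group[OF assms(1,2) assms(3,4)[unfolded Fabrykowski_Gupta_def]])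
  have "restrict (actFG FA) (tree 3) = FG.tree_act [Ra]" "restrict (actFG FB) (tree 3) = FG.tree_act [Rb]"
    by (auto simp: FG.tree_act_def out_FG)
  then show "(\<lambda>f. restrict f (tree 3)) ` {actFG FA, actFG FB} = (\<lambda>s. FG.tree_act [s]) ` {Ra, Rb}"
    by simp
  show "s \<in> {Ra, Rb} \<or> linv3 s \<in> {Ra, Rb}" for s by (cases s) auto
qed

theorem mainTheorem10:
  fixes \<Gamma> :: "('a, 'c) monoid_scheme"
    and G :: "(nat list \<Rightarrow> nat list) monoid"
    and \<phi> :: "'a \<Rightarrow> (nat list \<Rightarrow> nat list)"
  assumes "G \<in> {IMG_J, Gupta_Sidki, Fabrykowski_Gupta, Hanoi}"
    and "group \<Gamma>"
    and "finitely_presented \<Gamma>"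
    and "\<phi> \<in> hom \<Gamma> G"
    and "\<phi> ` carrier \<Gamma> = carrier G"
  shows "large \<Gamma>"
proof -
  consider "G = IMG_J" | "G = Gupta_Sidki" | "G = Fabrykowski_Gupta" | "G = Hanoi"
    using assms(1) by blast
  then show ?thesis
  proof cases
    case 1
    then show ?thesis using large_if_epi_IMG_J[OF assms(2,3), of \<phi>] assms(4,5) by simp
  next
    case 2
    then show ?thesis using large_if_epi_Gupta_Sidki[OF assms(2,3), of \<phi>] assms(4,5) by simp
  next
    case 3
    then show ?thesis using large_if_epi_Fabrykowski_Gupta[OF assms(2,3), of \<phi>] assms(4,5) by simp
  next
    case 4
    then show ?thesis using large_if_epi_Hanoi[OF assms(2,3), of \<phi>] assms(4,5) by simp
  qed
qed

end
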